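(* Let $U\subset\mathbb H$ be a holomorphic submanifold and let $E$ be the family of elliptic curves obtained by restricting $\widetilde{\mathcal E}$ to $U$. (1) There exists a unique equivariant refinement $s_{\mathrm U(1)}$ of the $\mathrm{MO}\langle8\rangle$-orientation for complex analytic elliptic cohomology for the curve $E$. (2) Furthermore, the equivariant refinement $s_{\mathrm U(1)}$ equals the twisted equivariant Euler class (determined by the twisted equivariant complex orientation given by $\upsilon(\tau,z)$) for the virtual vector bundle $V_3=(L_1-1)\otimes(L_2-1)\otimes(L_3-1)$. (3) In the universal case $E=\widetilde{\mathcal E}$, the refinement $s_{\mathrm U(1)}$ descends to the stack $\mathrm{Bun}_{\mathrm U(1)^{\times3}}(\mathcal E)$.
   Context: $\widetilde{\mathcal E}=(\mathbb C\times\mathbb H)/\mathbb Z^2\to\mathbb H$, $(n,m)\cdot(z,\tau)=(z+\tau n+m,\tau)$, is the universal family of elliptic curves over the upper half plane, $\widetilde{\mathcal E}^\vee=(\mathbb C\times\mathbb H)/\mathbb Z^2$, $(n,m)\cdot(z,\tau)=(z+n-\tau m,\tau)$, the dual family; $E,E^\vee\to U$ are their restrictions. $\mathrm{SL}_2(\mathbb Z)$ acts by $(z,\tau)\mapsto(\frac z{c\tau+d},\frac{a\tau+b}{c\tau+d})$; $\mathcal E^\vee=[\widetilde{\mathcal E}^\vee/\mathrm{SL}_2(\mathbb Z)]$, $\mathcal M_{\rm ell}=[\mathbb H/\mathrm{SL}_2(\mathbb Z)]$ and $\mathrm{Bun}_{\mathrm U(1)^{\times3}}(\mathcal E)\simeq\mathcal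 E^\vee\times_{\mathcal M_{\rm ell}}\mathcal E^\vee\times_{\mathcal M_{\rm ell}}\mathcal E^\vee$; over $U$, $\mathrm{Bun}_{\mathrm U(1)^{\times3}}(E)\simeq(E^\vee)^{\times3}$ (fiber product over $U$). Descent to the stack in (3) means $\mathrm{SL}_2(\mathbb Z)$-invariance. The complex analytic elliptic cohomology theory for $E$ is $\mathrm{Ell}=H(-;\mathcal O(U)[\beta,\beta^{-1}])$, $|\beta|=-2$, with its formal group identified with that of $E$ via the coordinate $z$ on $\mathbb C$; so $\mathrm{Ell}(B\mathrm U(1)^{\times3})$ in degree $0$ is functions on the formal neighborhood of the zero section in $(E^\vee)^{\times3}$. $L_i$ are the tautological line bundles on the three factors $B\mathrm U(1)\simeq\mathbb{CP}^\infty$ (resp. $[\mathrm{pt}/\mathrm U(1)]$). For a line bundle $\mathcal L$ on an elliptic curve, $\Theta^3(\mathcal L)$ is the line bundle on the triple product with fiber at $(x,y,z)$ $$\mathcal L_{x+y+z}\otimes\mathcal L_x\otimes\mathcal L_y\otimes\mathcal L_z\otimes\mathcal L_{x+y}^\vee\otimes\mathcal L_{x+z}^\vee\otimes\mathcal L_{y+z}^\vee\otimes\mathcal L_e^\vee.$$ $\mathcal O(-0)$ is the line bundle of functions vanishing to first order at the identity. A cubical structure on $\mathcal L$ is a section $s$ of $\Theta^3(\mathcal L)$ with $s(e,e,e)=1$, $s$ invariant under permutations of its arguments, and $s(w+x,y,z)s(w,x,z)=s(w,x+y,z)s(x,y,z)$ (up to canonical isomorphisms of lines). By the theorem of the cube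 $\mathcal O(-0)$ has a unique cubical structure; in the coordinates of the universal cover it is $$s=\frac{\sigma(\tau,x+y)\sigma(\tau,x+z)\sigma(\tau,y+z)\sigma(\tau,0)}{\sigma(\tau,x+y+z)\sigma(\tau,x)\sigma(\tau,y)\sigma(\tau,z)}=\frac{\upsilon(\tau,x+y)\upsilon(\tau,x+z)\upsilon(\tau,y+z)\upsilon(\tau,0)}{\upsilon(\tau,x+y+z)\upsilon(\tau,x)\upsilon(\tau,y)\upsilon(\tau,z)},$$ where $\sigma(\tau,z)=(y^{1/2}-y^{-1/2})\prod_{m>0}\frac{(1-q^my)(1-q^my^{-1})}{(1-q^m)^2}$ and $\upsilon(\tau,z)=-y^{1/2}\sigma(\tau,z)$ (with $y=e^{2\pi iz}$, $q=e^{2\pi i\tau}$), and the formula is understood as the expression of a section of $\Theta^3(\mathcal O(-0))$, the factor $\sigma(\tau,0)$ (resp. $\upsilon(\tau,0)$) standing for the element of the fiber of $\mathcal O(-0)$ at the identity determined by $\sigma$ (resp. $\upsilon$), i.e. by its first derivative at $0$. The Ando–Hopkins–Strickland characteristic class of $V_3$ for the canonical $\mathrm{MO}\langle8\rangle$- (i.e. $\mathrm{MString}$-) orientation of $\mathrm{Ell}$ is the class $s$ obtained by restricting this cubical structure to the formal neighborhood of the zero section. An equivariant refinement of the $\mathrm{MO}\langle8\rangle$-orientation is a $\Theta^3(\mathcal O(-0))$-twisted $\mathrm U(1)^{\times3}$-equivariant elliptic cohomology class of a point, i.e. a section $s_{\mathrm U(1)}\in\Gamma((E^\vee)^{\times3};\Theta^3(\mathcal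 O(-0)))$, whose image under the completion map (restriction to the formal neighborhood of the zero section, regarded as $\mathrm{Ell}(B\mathrm U(1)\times B\mathrm U(1)\times B\mathrm U(1))$) is the class $s$. The twisted equivariant Euler class of a line bundle $L$ (character of $\mathrm U(1)$ with coordinate $z$) is the section given by $\upsilon(\tau,z)$, which is the twisted equivariant refinement, unique up to unique isomorphism, of complex orientations of $\mathrm{Ell}$: a line bundle on $E^\vee$, with descent data given by the transformation cocycle of $\upsilon$, together with the section $\upsilon$ vanishing exactly to first order along the zero section. It extends multiplicatively to sums and formal differences of tensor products of the $L_i$ (with $L_1\otimes L_2$ having coordinate $x+y$, etc.), the resulting class for $V_3$ being regarded as a section of $\Theta^3(\mathcal O(-0))$ by the second expression for $s$ above. *)

theory Defs
  imports "HOL-Complex_Analysis.Complex_Analysis" "HOL-Library.Poly_Mapping"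
begin

section \<open>The base and the families over it\<close>

definition upper_half_plane :: "complex set" where
  "upper_half_plane = {\<tau>. Im \<tau> > 0}"

text \<open>Embedded complex submanifolds of the plane, by adapted holomorphic charts; the complex
  linear subspaces of the model space are \<^term>\<open>UNIV\<close> and \<^term>\<open>{0}\<close>.\<close>

definition holomorphic_submanifold :: "complex set \<Rightarrow> bool" where
  "holomorphic_submanifold U \<longleftrightarrow>
     (\<forall>u\<in>U. \<exists>W \<phi> S. open W \<and> u \<in> W \<and> \<phi> holomorphic_on W \<and> inj_on \<phi> W \<and>
        (S = UNIV \<or> S = {0}) \<and> \<phi> ` (W \<inter> U) = \<phi> ` W \<inter> S)"

definition complex_differentiable_at ::
    "(complex \<times> (complex ^ 'n) \<Rightarrow> complex) \<Rightarrow> complex \<times> (complex ^ 'n) \<Rightarrow> bool" where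
  "complex_differentiable_at F p \<longleftrightarrow>
     (\<exists>D. (F has_derivative D) (at p) \<and> (\<forall>c \<tau> v. D (c * \<tau>, c *s v) = c * D (\<tau>, v)))"

text \<open>Holomorphic functions on the complex manifold \<open>U \<times> \<complex>\<^sup>n\<close>: those which locally
  extend to holomorphic functions on the ambient space. Values off \<open>U \<times> \<complex>\<^sup>n\<close> are ignored.\<close>

definition holomorphic_over ::
    "complex set \<Rightarrow> (complex \<times> (complex ^ 'n) \<Rightarrow> complex) \<Rightarrow> bool" where
  "holomorphic_over U f \<longleftrightarrow>
     (\<forall>p\<in>U \<times> UNIV. \<exists>N F. open N \<and> p \<in> N \<and> (\<forall>q\<in>N. complex_differentiable_at F q) \<and>
        (\<forall>q\<in>N \<inter> (U \<times> UNIV). F q = f q))"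

text \<open>The preimage of the zero section in the fibre over \<open>\<tau>\<close> of \<open>\<complex> \<times> U \<rightarrow> E\<^sup>\<or>\<close>, for the
  action of \<open>\<int>\<^sup>2\<close> by \<open>z \<mapsto> z + n - \<tau> m\<close>.\<close>

definition period_lattice :: "complex \<Rightarrow> complex set" where
  "period_lattice \<tau> = {of_int n - \<tau> * of_int m | n m :: int. True}"

text \<open>A frame of the pullback of \<open>O(-0)\<close> to \<open>U \<times> \<complex>\<close>: a holomorphic function of \<open>(\<tau>, z)\<close>
  vanishing exactly along the zero section, and there exactly to first order.\<close>

definition frame_O :: "complex set \<Rightarrow> (complex \<Rightarrow> complex \<Rightarrow> complex) \<Rightarrow> bool" where
  "frame_O U l \<longleftrightarrow>
     holomorphic_over U (\<lambda>(\<tau>, v :: complex ^ 1). l \<tau> (v $ 1)) \<and>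
     (\<forall>\<tau>\<in>U. \<forall>z. (l \<tau> z = 0 \<longleftrightarrow> z \<in> period_lattice \<tau>) \<and>
        (z \<in> period_lattice \<tau> \<longrightarrow> deriv (l \<tau>) z \<noteq> 0))"


section \<open>Sections of \<open>\<Theta>\<^sup>3(O(-0))\<close>\<close>

text \<open>A point of \<open>U \<times> \<complex>\<^sup>3\<close> is a pair of \<open>\<tau>\<close> and \<open>v = (x, y, z)\<close>. Below \<open>L = O(-0)\<close>.
  As \<open>L\<close> is a sheaf of functions, a section of \<open>\<Theta>\<^sup>3(L)\<close> over \<open>(E\<^sup>\<or>)\<^sup>3\<close> is expressed
  by a lattice-invariant meromorphic function on \<open>U \<times> \<complex>\<^sup>3\<close>, here a function on the complement of
  the seven divisors that occur (set to \<open>0\<close> elsewhere, so that equal sections are equal functions).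
  The element of the fibre \<open>L\<^sub>e\<close> given by a function is recorded by its first derivative at
  \<open>0\<close>; this is the last factor in the denominator of \<open>theta3_frame\<close>.\<close>

definition off_divisors :: "complex set \<Rightarrow> (complex \<times> (complex ^ 3)) set" where
  "off_divisors U = {(\<tau>, v). \<tau> \<in> U \<and>
     (\<forall>w \<in> {v$1 + v$2 + v$3, v$1, v$2, v$3, v$1 + v$2, v$1 + v$3, v$2 + v$3}.
        w \<notin> period_lattice \<tau>)}"

text \<open>The frame of \<open>L\<^bsub>x+y+z\<^esub> \<otimes> L\<^sub>x \<otimes> L\<^sub>y \<otimes> L\<^sub>z \<otimes> L\<^sup>\<or>\<^bsub>x+y\<^esub> \<otimes> L\<^sup>\<or>\<^bsub>x+z\<^esub> \<otimes> L\<^sup>\<or>\<^bsub>y+z\<^esub> \<otimes> L\<^sup>\<or>\<^sub>e\<close>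
  determined by a frame \<open>l\<close> of \<open>L\<close>.\<close>

definition theta3_frame ::
    "(complex \<Rightarrow> complex \<Rightarrow> complex) \<Rightarrow> complex \<times> (complex ^ 3) \<Rightarrow> complex" where
  "theta3_frame l = (\<lambda>(\<tau>, v).
     (l \<tau> (v$1 + v$2 + v$3) * l \<tau> (v$1) * l \<tau> (v$2) * l \<tau> (v$3)) /
     (l \<tau> (v$1 + v$2) * l \<tau> (v$1 + v$3) * l \<tau> (v$2 + v$3) * deriv (l \<tau>) 0))"

text \<open>Two mutually dual conventions for \<open>\<Theta>\<^sup>3\<close> are in use. With the fibre displayed above, the
  customary fraction
  \<open>\<sigma>(x+y) \<sigma>(x+z) \<sigma>(y+z) \<sigma>(0) / (\<sigma>(x+y+z) \<sigma>(x) \<sigma>(y) \<sigma>(z))\<close> for the cubical structure,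
  in which \<open>\<sigma>(0)\<close> is an element of \<open>L\<^sub>e\<close>, lies in the dual line \<open>\<Theta>\<^sup>3(L)\<^sup>\<or>\<close>, and the cubical
  structure is the section of \<open>\<Theta>\<^sup>3(L)\<close> dual (inverse) to it; if instead \<open>\<Theta>\<^sup>3(L)\<close> denotes the dual
  line, the fraction is itself the section. All notions carry an exponent \<open>\<epsilon>\<close>
  to cover both: \<open>\<epsilon> = 1\<close> is the displayed fibre and \<open>\<epsilon> = -1\<close> its dual.\<close>

definition theta3_coordinate :: "int \<Rightarrow> complex set \<Rightarrow> (complex \<Rightarrow> complex \<Rightarrow> complex) \<Rightarrow>
    (complex \<times> (complex ^ 3) \<Rightarrow> complex) \<Rightarrow> (complex \<times> (complex ^ 3) \<Rightarrow> complex) \<Rightarrow> bool" where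
  "theta3_coordinate \<epsilon> U l s h \<longleftrightarrow>
     holomorphic_over U h \<and> (\<forall>p\<in>off_divisors U. s p = h p * theta3_frame l p powi \<epsilon>)"

definition theta3_section ::
    "int \<Rightarrow> complex set \<Rightarrow> (complex \<times> (complex ^ 3) \<Rightarrow> complex) \<Rightarrow> bool" where
  "theta3_section \<epsilon> U s \<longleftrightarrow>
     (\<forall>p. p \<notin> off_divisors U \<longrightarrow> s p = 0) \<and>
     (\<forall>\<tau>\<in>U. \<forall>v. \<forall>n m :: int ^ 3.
        s (\<tau>, \<chi> i. v $ i + of_int (n $ i) - \<tau> * of_int (m $ i)) = s (\<tau>, v)) \<and>
     (\<exists>l h. frame_O U l \<and> theta3_coordinate \<epsilon> U l s h)"

text \<open>At the point \<open>(e, e, e)\<close> the canonical isomorphism of the fibre with \<open>\<complex>\<close> sends the frame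
  determined by any \<open>l\<close> to \<open>1\<close>, so the value of a section there is that of its coordinate.
  The cocycle identity of meromorphic sections is imposed where all four factors are regular.\<close>

definition cubical_structure ::
    "int \<Rightarrow> complex set \<Rightarrow> (complex \<times> (complex ^ 3) \<Rightarrow> complex) \<Rightarrow> bool" where
  "cubical_structure \<epsilon> U s \<longleftrightarrow>
     theta3_section \<epsilon> U s \<and>
     (\<exists>l h. frame_O U l \<and> theta3_coordinate \<epsilon> U l s h \<and> (\<forall>\<tau>\<in>U. h (\<tau>, 0) = 1)) \<and>
     (\<forall>\<pi> :: 3 \<Rightarrow> 3. bij \<pi> \<longrightarrow> (\<forall>\<tau> v. s (\<tau>, \<chi> i. v $ \<pi> i) = s (\<tau>, v))) \<and>
     (\<forall>\<tau> w x y z.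
        {(\<tau>, vector [w + x, y, z]), (\<tau>, vector [w, x, z]),
         (\<tau>, vector [w, x + y, z]), (\<tau>, vector [x, y, z])} \<subseteq> off_divisors U \<longrightarrow>
        s (\<tau>, vector [w + x, y, z]) * s (\<tau>, vector [w, x, z]) =
        s (\<tau>, vector [w, x + y, z]) * s (\<tau>, vector [x, y, z]))"


section \<open>Completion and equivariant refinements\<close>

text \<open>\<open>Ell(BU(1)\<^sup>3)\<close> in degree \<open>0\<close> is the ring of power series in \<open>x, y, z\<close> over the functions on
  \<open>U\<close>. Near the zero section the coordinate \<open>z\<close> is a frame of \<open>O(-0)\<close>; the completion of a section
  is the Taylor series along the zero section of its coordinate in the corresponding
  frame of \<open>\<Theta>\<^sup>3\<close>. A power series is given by its coefficients, as functions of \<open>\<tau>\<close>.\<close>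

definition has_formal_expansion :: "int \<Rightarrow> complex set \<Rightarrow> (complex \<times> (complex ^ 3) \<Rightarrow> complex) \<Rightarrow>
    complex \<Rightarrow> (nat \<times> nat \<times> nat \<Rightarrow> complex) \<Rightarrow> bool" where
  "has_formal_expansion \<epsilon> U s \<tau> c \<longleftrightarrow>
     (\<exists>r>0. \<forall>v. norm v < r \<and> (\<tau>, v) \<in> off_divisors U \<longrightarrow>
        ((\<lambda>(i, j, k). c (i, j, k) * (v$1) ^ i * (v$2) ^ j * (v$3) ^ k) has_sum
           (s (\<tau>, v) / theta3_frame (\<lambda>_ z. z) (\<tau>, v) powi \<epsilon>)) UNIV)"

definition completion :: "int \<Rightarrow> complex set \<Rightarrow> (complex \<times> (complex ^ 3) \<Rightarrow> complex) \<Rightarrow>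
    nat \<times> nat \<times> nat \<Rightarrow> complex \<Rightarrow> complex" where
  "completion \<epsilon> U s i \<tau> = (if \<tau> \<in> U then (THE c. has_formal_expansion \<epsilon> U s \<tau> c) i else 0)"

text \<open>The Ando-Hopkins-Strickland class of \<open>V\<^sub>3\<close> for the \<open>MO\<langle>8\<rangle>\<close>-orientation.\<close>

definition AHS_class :: "int \<Rightarrow> complex set \<Rightarrow> nat \<times> nat \<times> nat \<Rightarrow> complex \<Rightarrow> complex" where
  "AHS_class \<epsilon> U = completion \<epsilon> U (THE s. cubical_structure \<epsilon> U s)"

definition equivariant_refinement ::
    "int \<Rightarrow> complex set \<Rightarrow> (complex \<times> (complex ^ 3) \<Rightarrow> complex) \<Rightarrow> bool" where
  "equivariant_refinement \<epsilon> U s \<longleftrightarrow> theta3_section \<epsilon> U s \<and> completion \<epsilon> U s = AHS_class \<epsilon> U"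


section \<open>The twisted equivariant Euler class\<close>

definition sigma :: "complex \<Rightarrow> complex \<Rightarrow> complex" where
  "sigma \<tau> z =
     (let q = exp (2 * of_real pi * \<i> * \<tau>); y = exp (2 * of_real pi * \<i> * z)
      in (exp (of_real pi * \<i> * z) - exp (- (of_real pi * \<i> * z))) *
         prodinf (\<lambda>m. (1 - q ^ Suc m * y) * (1 - q ^ Suc m * inverse y) / (1 - q ^ Suc m)\<^sup>2))"

definition upsilon :: "complex \<Rightarrow> complex \<Rightarrow> complex" where
  "upsilon \<tau> z = - exp (of_real pi * \<i> * z) * sigma \<tau> z"

text \<open>The representation ring of \<open>U(1)\<^sup>3\<close> is the group ring of the character group \<open>\<int>\<^sup>3\<close>.\<close>

type_synonym rep_ring = "(int ^ 3) \<Rightarrow>\<^sub>0 int"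

definition taut :: "3 \<Rightarrow> rep_ring" where
  "taut i = Poly_Mapping.single (axis i 1) 1"

definition V3 :: rep_ring where
  "V3 = (taut 1 - 1) * (taut 2 - 1) * (taut 3 - 1)"

text \<open>The Euler class of the character \<open>a\<close>, with coordinate \<open>a \<cdot> v\<close>; for the trivial
  character it is the element of \<open>L\<^sub>e\<close> determined by the orientation \<open>\<theta>\<close>, i.e. the first derivative
  at \<open>0\<close>.\<close>

definition euler_character :: "(complex \<Rightarrow> complex \<Rightarrow> complex) \<Rightarrow> int ^ 3 \<Rightarrow>
    complex \<times> (complex ^ 3) \<Rightarrow> complex" where
  "euler_character \<theta> a = (\<lambda>(\<tau>, v).
     if a = 0 then deriv (\<theta> \<tau>) 0 else \<theta> \<tau> (\<Sum>i\<in>UNIV. of_int (a $ i) * v $ i))"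

definition euler_class :: "(complex \<Rightarrow> complex \<Rightarrow> complex) \<Rightarrow> rep_ring \<Rightarrow>
    complex \<times> (complex ^ 3) \<Rightarrow> complex" where
  "euler_class \<theta> V p =
     (\<Prod>a\<in>Poly_Mapping.keys V. euler_character \<theta> a p powi Poly_Mapping.lookup V a)"


section \<open>Descent to the stack\<close>

text \<open>Invariance under pullback along \<open>(\<tau>, v) \<mapsto> ((a\<tau>+b)/(c\<tau>+d), v/(c\<tau>+d))\<close>. Pulling back a function
  multiplies its \<open>z\<close>-derivative at \<open>0\<close> by \<open>(c\<tau>+d)\<^sup>-\<^sup>1\<close>, so the factor \<open>L\<^sup>\<or>\<^sub>e\<close> contributes
  \<open>c\<tau>+d\<close>.\<close>

definition SL2Z_invariant :: "int \<Rightarrow> (complex \<times> (complex ^ 3) \<Rightarrow> complex) \<Rightarrow> bool" where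
  "SL2Z_invariant \<epsilon> s \<longleftrightarrow>
     (\<forall>a b c d :: int. a * d - b * c = 1 \<longrightarrow>
       (\<forall>\<tau>\<in>upper_half_plane. \<forall>v.
          (of_int c * \<tau> + of_int d) powi \<epsilon> *
          s ((of_int a * \<tau> + of_int b) / (of_int c * \<tau> + of_int d),
             inverse (of_int c * \<tau> + of_int d) *s v) = s (\<tau>, v)))"

end

theory Submission
  imports Defs
begin

text \<open>For a fixed \<open>\<tau>\<close> the whole theorem rests on one rigidity statement,
\<open>theta3_rigidity\<close>: up to a constant, \<open>\<Theta>\<^sup>3(O(-0))\<close> has
only one section. Any frame \<open>l\<close> of \<open>O(-0)\<close> is \<open>g
\<upsilon>\<close> with \<open>g\<close> entire and without zeros, because \<open>l\<close> and
\<open>\<upsilon>\<close> have the same simple zeros. So every section is \<open>H\<close> times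
the (possibly inverted) theta frame of \<open>\<upsilon>\<close>, with \<open>H\<close>
holomorphic on \<open>\<complex>\<^sup>3\<close>. Under translation by a lattice vector
\<open>\<upsilon>\<close> is multiplied by the exponential of a polynomial of degree two without
constant term in the translation and the coordinate. The alternating sum over the cube that
defines \<open>\<Theta>\<^sup>3\<close> is a third difference, and it annihilates such
polynomials, so the theta frame of \<open>\<upsilon>\<close> is lattice-invariant. Hence
\<open>H\<close> is lattice-invariant as well, and Liouville's theorem, applied to one variable
after the other, makes it constant.

The constant equals the value of the section at \<open>(e, e, e)\<close>. If that value is
\<open>1\<close>, the section is the theta frame of \<open>\<upsilon>\<close> itself. This
identifies the cubical structure (\<open>cubical_structure_iff\<close>), hence the class of
\<open>V\<^sub>3\<close>, and it also settles uniqueness of the refinement: the constant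
\<open>k(\<tau>)\<close> of a section multiplies its Taylor series along the zero section, the
Taylor series is determined by the section, and that of the cubical structure is not zero, so
equality of completions forces \<open>k = 1\<close> (\<open>equivariant_refinement_iff\<close>).
Expanding the product \<open>(L\<^sub>1 - 1)(L\<^sub>2 - 1)(L\<^sub>3 - 1)\<close> shows that
the theta frame of \<open>\<upsilon>\<close> is the Euler class of \<open>V\<^sub>3\<close>
(\<open>euler_class_V3\<close>).

For modular invariance, transport \<open>\<upsilon>\<close> along an element of
\<open>SL\<^sub>2(\<int>)\<close>. The result is another function with simple zeros exactly on
the lattice, whose theta frame is again lattice-invariant and takes the value \<open>1\<close>
at the origin in its own coordinate; by rigidity it agrees with that of
\<open>\<upsilon>\<close> (\<open>SL2Z_invariant_euler_section\<close>).

Two analytic facts remain. The function \<open>\<upsilon>\<close> must be a frame jointly in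
\<open>\<tau>\<close> and \<open>z\<close>; it is an infinite product that converges locally
uniformly, hence continuous and holomorphic in each variable, and this implies joint
differentiability. And the completion must exist, which means that theta frames have convergent
power series in three variables.\<close>

(* Formal power series also claim the dollar sign; with both readings, parsing a term takes time
   exponential in its number of vector components. *)
no_notation fps_nth (infixl \<open>$\<close> 75)

section \<open>Holomorphy in two variables\<close>

text \<open>Osgood's lemma. The partial derivative in the second variable is continuous: Cauchy's inequality
bounds the difference of two such derivatives by the difference of the functions on a circle,
and that is small by uniform continuity. One continuous partial derivative together with the
mere existence of the other gives total differentiability.\<close>

lemma separately_holomorphic_imp_differentiable:
  fixes f :: "complex \<times> complex \<Rightarrow> complex"
  assumes "open N" and cont: "continuous_on N f"
    and hol1: "\<And>a b. (a, b) \<in> N \<Longrightarrow> (\<lambda>t. f (t, b)) field_differentiable at a"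
    and hol2: "\<And>a b. (a, b) \<in> N \<Longrightarrow> (\<lambda>t. f (a, t)) field_differentiable at b"
    and "(a, b) \<in> N"
  shows "\<exists>A B. (f has_derivative (\<lambda>(s, t). A * s + B * t)) (at (a, b))"
proof -
  obtain S T where ST: "open S" "open T" "a \<in> S" "b \<in> T" "S \<times> T \<subseteq> N"
    using \<open>open N\<close> \<open>(a, b) \<in> N\<close> by (auto elim!: open_prod_elim)
  obtain r1 where r1: "r1 > 0" "cball a r1 \<subseteq> S" using ST open_contains_cball by blast
  obtain r2 where r2: "r2 > 0" "cball b r2 \<subseteq> T" using ST open_contains_cball by blast
  define r where "r = r2 / 2"
  have "r > 0" using r2 by (simp add: r_def)
  have inN: "(x, y) \<in> N" if "x \<in> cball a r1" "y \<in> cball b r2" for x y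
    using that r1 r2 ST by blast
  have hol: "(\<lambda>t. f (x, t)) holomorphic_on cball b r2" if "x \<in> cball a r1" for x
    unfolding holomorphic_on_def using inN[OF that] hol2 field_differentiable_at_within by blast
  define g where "g = (\<lambda>x y. deriv (\<lambda>t. f (x, t)) y)"
  have sub: "cball y r \<subseteq> cball b r2" if "y \<in> ball b r" for y
  proof
    fix t assume "t \<in> cball y r"
    then have "dist y t \<le> r" "dist b y < r" using that by auto
    then show "t \<in> cball b r2" using dist_triangle[of b t y] by (simp add: r_def)
  qed
  have unif: "uniformly_continuous_on (cball a r1 \<times> cball b r2) f"
    using inN by (intro compact_uniformly_continuous compact_Times)
      (auto intro!: continuous_on_subset[OF cont])
  have g_cont: "continuous (at (a, b)) (\<lambda>(x, y). g x y)"
    unfolding continuous_at_eps_delta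
  proof (intro allI impI)
    fix e :: real assume "e > 0"
    \<comment> \<open>Cauchy's inequality on a circle of radius \<open>r\<close> costs a factor \<open>1 / r\<close>.\<close>
    define e' where "e' = e * r / 4"
    have "e' > 0" using \<open>e > 0\<close> \<open>r > 0\<close> by (simp add: e'_def)
    then obtain d1 where d1: "d1 > 0"
      "\<And>p p'. p \<in> cball a r1 \<times> cball b r2 \<Longrightarrow> p' \<in> cball a r1 \<times> cball b r2 \<Longrightarrow>
          dist p' p < d1 \<Longrightarrow> dist (f p') (f p) < e'"
      using unif unfolding uniformly_continuous_on_def by meson
    have "(\<lambda>t. f (a, t)) holomorphic_on ball b r2"
      using hol[of a] r1 by (auto intro: holomorphic_on_subset)
    then have "continuous_on (ball b r2) (g a)"
      unfolding g_def by (intro holomorphic_on_imp_continuous_on holomorphic_deriv) auto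
    then have "isCont (g a) b" using r2 by (simp add: continuous_on_eq_continuous_at)
    then obtain d2 where d2: "d2 > 0" "\<And>y. dist y b < d2 \<Longrightarrow> dist (g a y) (g a b) < e / 2"
      unfolding continuous_at_eps_delta using \<open>e > 0\<close> by (meson half_gt_zero)
    define d where "d = Min {d1, d2, r1, r}"
    have d: "d > 0" "d \<le> d1" "d \<le> d2" "d \<le> r1" "d \<le> r"
      using d1 d2 r1 \<open>r > 0\<close> by (auto simp: d_def)
    show "\<exists>d>0. \<forall>p'. dist p' (a, b) < d \<longrightarrow>
        dist (case p' of (x, y) \<Rightarrow> g x y) (case (a, b) of (x, y) \<Rightarrow> g x y) < e"
    proof (intro exI[of _ d] conjI allI impI d)
      fix p' assume p': "dist p' (a, b) < d"
      obtain x y where [simp]: "p' = (x, y)" by (cases p')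
      have xy: "dist x a < d" "dist y b < d"
        using p' dist_fst_le[of p' "(a, b)"] dist_snd_le[of p' "(a, b)"] by auto
      have x: "x \<in> cball a r1" and y: "y \<in> ball b r" and a: "a \<in> cball a r1"
        using xy d r1 by (auto simp: dist_commute)
      have h: "(\<lambda>t. f (x, t)) holomorphic_on cball y r" "(\<lambda>t. f (a, t)) holomorphic_on cball y r"
        using hol[OF x] hol[OF a] sub[OF y] by (auto intro: holomorphic_on_subset)
      have y': "y \<in> cball b r2" using sub[OF y] \<open>r > 0\<close> by (meson centre_in_cball less_imp_le subsetD)
      have "norm ((deriv ^^ 1) (\<lambda>t. f (x, t) - f (a, t)) y) \<le> fact 1 * e' / r ^ 1"
      proof (rule Cauchy_inequality)
        show "(\<lambda>t. f (x, t) - f (a, t)) holomorphic_on ball y r"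
          using h by (intro holomorphic_intros) (auto intro: holomorphic_on_subset)
        show "continuous_on (cball y r) (\<lambda>t. f (x, t) - f (a, t))"
          using h by (intro continuous_intros holomorphic_on_imp_continuous_on)
        fix t assume "norm (y - t) = r"
        then have "t \<in> cball b r2" using sub[OF y] by (auto simp: dist_norm)
        moreover have "dist (x, t) (a, t) < d1" using xy d by (simp add: dist_Pair_Pair)
        ultimately have "dist (f (x, t)) (f (a, t)) < e'" using d1(2)[of "(a, t)" "(x, t)"] x a by auto
        then show "norm (f (x, t) - f (a, t)) \<le> e'" by (simp add: dist_norm)
      qed fact
      moreover have "(deriv ^^ 1) (\<lambda>t. f (x, t) - f (a, t)) y = g x y - g a y"
        unfolding g_def using inN[OF x y'] inN[OF a y'] hol2 by simp
      ultimately have "dist (g x y) (g a y) \<le> e / 4"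
        using \<open>r > 0\<close> by (simp add: dist_norm e'_def)
      moreover have "dist (g a y) (g a b) < e / 2" using d2 xy d by auto
      ultimately have "dist (g x y) (g a b) < e"
        using dist_triangle[of "g x y" "g a b" "g a y"] \<open>e > 0\<close> by simp
      then show "dist (case p' of (x, y) \<Rightarrow> g x y) (case (a, b) of (x, y) \<Rightarrow> g x y) < e" by simp
    qed
  qed
  let ?X = "ball a r1" and ?Y = "ball b r"
  have "((\<lambda>(x, y). f (x, y)) has_derivative
      (\<lambda>(s, t). deriv (\<lambda>t. f (t, b)) a * s + blinfun_mult_right (g a b) t)) (at (a, b) within ?X \<times> ?Y)"
  proof (rule has_derivative_partialsI)
    have "((\<lambda>t. f (t, b)) has_field_derivative deriv (\<lambda>t. f (t, b)) a) (at a)"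
      using hol1 \<open>(a, b) \<in> N\<close> field_differentiable_derivI by blast
    then show "((\<lambda>x. f (x, b)) has_derivative (\<lambda>s. deriv (\<lambda>t. f (t, b)) a * s)) (at a within ?X)"
      by (simp add: has_field_derivative_def has_derivative_at_withinI)
    fix x y assume "x \<in> ?X" "y \<in> ?Y"
    then have "x \<in> cball a r1" "y \<in> cball b r2"
      using subsetD[OF sub[of y], of y] \<open>r > 0\<close> by auto
    then have "(x, y) \<in> N" by (rule inN)
    then have "((\<lambda>t. f (x, t)) has_field_derivative g x y) (at y)"
      using hol2 field_differentiable_derivI unfolding g_def by blast
    then show "((\<lambda>y. f (x, y)) has_derivative blinfun_mult_right (g x y)) (at y within ?Y)"
      by (simp add: has_field_derivative_def has_derivative_at_withinI)
  next
    have "continuous (at (a, b) within ?X \<times> ?Y) (\<lambda>p. blinfun_mult_right (case p of (x, y) \<Rightarrow> g x y))"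
      by (rule bounded_linear.continuous[OF bounded_linear_blinfun_mult_right
            continuous_at_imp_continuous_at_within[OF g_cont]])
    then show "continuous (at (a, b) within ?X \<times> ?Y) (\<lambda>(x, y). blinfun_mult_right (g x y))"
      by (simp add: case_prod_unfold)
  qed (use \<open>r > 0\<close> in auto)
  moreover have "at (a, b) within ?X \<times> ?Y = at (a, b)"
    using r1 \<open>r > 0\<close> by (intro at_within_open) (auto simp: open_Times)
  ultimately show ?thesis by (auto simp: case_prod_unfold)
qed

text \<open>Weierstrass' theorem along a curve \<open>j\<close> into a domain of two variables, for use with
the two coordinate slices.\<close>

lemma locally_uniform_limit_slice:
  fixes f :: "nat \<Rightarrow> complex \<times> complex \<Rightarrow> complex" and j :: "complex \<Rightarrow> complex \<times> complex"
  assumes "open N" and j: "continuous_on UNIV j"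
    and hol: "\<And>n t. j t \<in> N \<Longrightarrow> (\<lambda>t. f n (j t)) field_differentiable at t"
    and lim: "\<And>K. compact K \<Longrightarrow> K \<subseteq> N \<Longrightarrow> uniform_limit K f g sequentially"
    and "j a \<in> N"
  shows "(\<lambda>t. g (j t)) field_differentiable at a"
proof -
  define S where "S = j -` N"
  have "open S" unfolding S_def using \<open>open N\<close> j by (simp add: continuous_on_open_vimage)
  have "(\<lambda>t. g (j t)) holomorphic_on S"
  proof (rule holomorphic_uniform_sequence[where f = "\<lambda>n t. f n (j t)"])
    fix x assume "x \<in> S"
    then obtain r where r: "r > 0" "cball x r \<subseteq> S" using \<open>open S\<close> open_contains_cball by blast
    have "uniform_limit (j ` cball x r) f g sequentially"
    proof (rule lim)
      show "compact (j ` cball x r)"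
        by (rule compact_continuous_image[OF continuous_on_subset[OF j]]) auto
      show "j ` cball x r \<subseteq> N" using r by (auto simp: S_def)
    qed
    then have "uniform_limit (cball x r) (\<lambda>n t. f n (j t)) (\<lambda>t. g (j t)) sequentially"
      by (simp add: uniform_limit_iff)
    then show "\<exists>d>0. cball x d \<subseteq> S \<and> uniform_limit (cball x d) (\<lambda>n t. f n (j t)) (\<lambda>t. g (j t)) sequentially"
      using r by blast
  next
    show "(\<lambda>t. f n (j t)) holomorphic_on S" for n
      unfolding holomorphic_on_def S_def using hol field_differentiable_at_within by blast
  qed fact
  then show "(\<lambda>t. g (j t)) field_differentiable at a"
    using \<open>j a \<in> N\<close> \<open>open S\<close> by (auto simp: S_def intro: holomorphic_on_imp_differentiable_at)
qed

lemma locally_uniform_limit_continuous: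
  fixes f :: "nat \<Rightarrow> 'a::euclidean_space \<Rightarrow> 'b::metric_space"
  assumes "open N" and cont: "\<And>n. continuous_on N (f n)"
    and lim: "\<And>K. compact K \<Longrightarrow> K \<subseteq> N \<Longrightarrow> uniform_limit K f g sequentially"
  shows "continuous_on N g"
proof (subst continuous_on_eq_continuous_at[OF \<open>open N\<close>], intro ballI)
  fix p assume "p \<in> N"
  then obtain r where r: "r > 0" "cball p r \<subseteq> N" using \<open>open N\<close> open_contains_cball by blast
  have "continuous_on (cball p r) g"
  proof (rule uniform_limit_theorem)
    show "uniform_limit (cball p r) f g sequentially" using r by (intro lim) auto
    show "\<forall>\<^sub>F n in sequentially. continuous_on (cball p r) (f n)"
      using r cont by (meson always_eventually continuous_on_subset)
  qed simp
  then show "isCont g p" using r by (simp add: continuous_on_interior)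
qed

section \<open>The product defining \<open>\<upsilon>\<close>\<close>

definition sigma_factor :: "nat \<Rightarrow> complex \<times> complex \<Rightarrow> complex" where
  "sigma_factor m = (\<lambda>(\<tau>, z).
     let q = exp (2 * of_real pi * \<i> * \<tau>); y = exp (2 * of_real pi * \<i> * z)
     in (1 - q ^ Suc m * y) * (1 - q ^ Suc m * inverse y) / (1 - q ^ Suc m)\<^sup>2)"

definition sigma_product :: "complex \<times> complex \<Rightarrow> complex" where
  "sigma_product p = prodinf (\<lambda>m. sigma_factor m p)"

lemma nome_norm_less_1: "Im \<tau> > 0 \<Longrightarrow> norm (exp (2 * of_real pi * \<i> * \<tau>)) < 1"
  by simp

lemma nome_power_neq_1:
  assumes "Im \<tau> > 0" shows "exp (2 * of_real pi * \<i> * \<tau>) ^ Suc m \<noteq> 1"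
proof
  assume "exp (2 * of_real pi * \<i> * \<tau>) ^ Suc m = 1"
  then have "norm (exp (2 * of_real pi * \<i> * \<tau>)) ^ Suc m = 1" by (metis norm_power norm_one)
  moreover have "norm (exp (2 * of_real pi * \<i> * \<tau>)) ^ Suc m < 1"
    by (rule power_Suc_less_one[OF _ nome_norm_less_1[OF assms]]) simp
  ultimately show False by simp
qed

text \<open>The cross terms combine to a single factor \<open>q\<^bsup>m+1\<^esup>\<close>, which makes the
convergence of the product a comparison with a geometric series.\<close>

lemma sigma_factor_minus_1:
  fixes z :: complex
  assumes "Im \<tau> > 0"
  defines "q \<equiv> exp (2 * of_real pi * \<i> * \<tau>)" and "y \<equiv> exp (2 * of_real pi * \<i> * z)"
  shows "sigma_factor m (\<tau>, z) - 1 = q ^ Suc m * (2 - y - inverse y) / (1 - q ^ Suc m)\<^sup>2"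
proof -
  define Q where "Q = q ^ Suc m"
  have "Q \<noteq> 1" using nome_power_neq_1[OF assms(1)] by (simp add: Q_def q_def)
  have "y \<noteq> 0" by (simp add: y_def)
  have "(1 - Q * y) * (1 - Q * inverse y) / (1 - Q)\<^sup>2 - 1 = Q * (2 - y - inverse y) / (1 - Q)\<^sup>2"
    using \<open>Q \<noteq> 1\<close> \<open>y \<noteq> 0\<close> by (simp add: divide_simps) (simp add: power2_eq_square algebra_simps)
  then show ?thesis by (simp add: sigma_factor_def Let_def Q_def q_def y_def)
qed

abbreviation half_plane_times_plane :: "(complex \<times> complex) set" where
  "half_plane_times_plane \<equiv> upper_half_plane \<times> UNIV"

lemma open_upper_half_plane: "open upper_half_plane"
  unfolding upper_half_plane_def by (rule open_halfspace_Im_gt)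

lemma sigma_factor_bound:
  assumes "compact K" "K \<subseteq> half_plane_times_plane"
  obtains \<rho> B where "0 \<le> \<rho>" "\<rho> < 1"
    "\<And>p m. p \<in> K \<Longrightarrow> norm (sigma_factor m p - 1) \<le> \<rho> ^ Suc m * B"
proof (cases "K = {}")
  case True then show ?thesis by (intro that[of 0 0]) auto
next
  case False
  have "continuous_on K (\<lambda>p. norm (exp (2 * of_real pi * \<i> * fst p)))"
    by (intro continuous_intros)
  then obtain p0 where p0: "p0 \<in> K" "\<And>p. p \<in> K \<Longrightarrow>
      norm (exp (2 * of_real pi * \<i> * fst p)) \<le> norm (exp (2 * of_real pi * \<i> * fst p0))"
    using continuous_attains_sup[OF \<open>compact K\<close> False] by blast
  define \<rho> where "\<rho> = norm (exp (2 * of_real pi * \<i> * fst p0))"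
  have "\<rho> < 1" "\<rho> \<ge> 0" using p0(1) assms(2) nome_norm_less_1[of "fst p0"]
    by (auto simp: \<rho>_def upper_half_plane_def)
  let ?f = "\<lambda>p::complex \<times> complex. 2 - exp (2 * of_real pi * \<i> * snd p) - inverse (exp (2 * of_real pi * \<i> * snd p))"
  have "continuous_on K ?f" by (intro continuous_intros) auto
  then have "bounded (?f ` K)" by (intro compact_imp_bounded compact_continuous_image assms)
  then obtain B where B: "\<And>p. p \<in> K \<Longrightarrow> norm (?f p) \<le> B" "B > 0" unfolding bounded_pos by auto
  show ?thesis
  proof (rule that)
    fix p m assume "p \<in> K"
    obtain \<tau> z where p: "p = (\<tau>, z)" by (cases p)
    define q where "q = exp (2 * of_real pi * \<i> * \<tau>)"
    have "Im \<tau> > 0" using \<open>p \<in> K\<close> assms(2) p by (auto simp: upper_half_plane_def)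
    have q: "norm q \<le> \<rho>" using p0(2)[OF \<open>p \<in> K\<close>] by (simp add: q_def \<rho>_def p)
    have "norm (q ^ Suc m) \<le> \<rho> ^ Suc m" unfolding norm_power by (rule power_mono[OF q]) simp
    moreover have "\<rho> ^ Suc m \<le> \<rho>" using \<open>\<rho> < 1\<close> \<open>\<rho> \<ge> 0\<close> by (simp add: mult_left_le power_le_one)
    ultimately have Q: "norm (q ^ Suc m) \<le> \<rho> ^ Suc m" "1 - \<rho> \<le> norm (1 - q ^ Suc m)"
      using norm_triangle_ineq2[of 1 "q ^ Suc m"] by auto
    have "norm (sigma_factor m p - 1) = norm (q ^ Suc m) * norm (?f p) / (norm (1 - q ^ Suc m))\<^sup>2"
      unfolding p sigma_factor_minus_1[OF \<open>Im \<tau> > 0\<close>] q_def[symmetric]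
      by (simp only: norm_mult norm_divide norm_power snd_conv)
    also have "\<dots> \<le> \<rho> ^ Suc m * B / (1 - \<rho>)\<^sup>2"
      using Q B(1)[OF \<open>p \<in> K\<close>] B(2) \<open>\<rho> < 1\<close> \<open>\<rho> \<ge> 0\<close>
      by (intro frac_le mult_mono power_mono) auto
    finally show "norm (sigma_factor m p - 1) \<le> \<rho> ^ Suc m * (B / (1 - \<rho>)\<^sup>2)" by simp
  qed fact+
qed

lemma continuous_sigma_factor: "continuous_on half_plane_times_plane (sigma_factor m)"
  unfolding sigma_factor_def Let_def case_prod_unfold
  by (intro continuous_intros) (auto simp: upper_half_plane_def dest: nome_power_neq_1[of _ m])

lemma convergent_sigma_product:
  assumes "p \<in> half_plane_times_plane" shows "convergent_prod (\<lambda>m. sigma_factor m p)"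
proof -
  obtain \<rho> B where \<rho>: "0 \<le> \<rho>" "\<rho> < 1" "\<And>m. norm (sigma_factor m p - 1) \<le> \<rho> ^ Suc m * B"
    using sigma_factor_bound[of "{p}"] assms by (metis compact_sing empty_subsetI insert_subset singletonI)
  have "summable (\<lambda>m. \<rho> ^ Suc m * B)"
    using \<rho> by (intro summable_mult2) (simp add: summable_Suc_iff summable_geometric)
  then have "summable (\<lambda>m. norm (sigma_factor m p - 1))"
    by (rule summable_comparison_test'[where N = 0]) (simp add: \<rho>(3) del: power_Suc)
  then show ?thesis
    by (intro abs_convergent_prod_imp_convergent_prod summable_imp_abs_convergent_prod)
qed

lemma sigma_product_uniform_limit:
  assumes "compact K" "K \<subseteq> half_plane_times_plane"
  shows "uniform_limit K (\<lambda>N p. \<Prod>m<N. sigma_factor m p) sigma_product sequentially"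
proof -
  obtain \<rho> B where \<rho>: "0 \<le> \<rho>" "\<rho> < 1"
    "\<And>p m. p \<in> K \<Longrightarrow> norm (sigma_factor m p - 1) \<le> \<rho> ^ Suc m * B"
    using sigma_factor_bound[OF assms] by blast
  have "summable (\<lambda>m. \<rho> ^ Suc m * B)"
    using \<rho> by (intro summable_mult2) (simp add: summable_Suc_iff summable_geometric)
  then have "uniformly_convergent_on K (\<lambda>N p. \<Sum>m<N. norm (sigma_factor m p - 1))"
    by (rule Weierstrass_m_test'[rotated]) (simp add: \<rho> del: power_Suc)
  then have "uniformly_convergent_on K (\<lambda>N p. \<Prod>m<N. sigma_factor m p)"
    by (intro uniformly_convergent_on_prod' assms(1) continuous_on_subset[OF continuous_sigma_factor assms(2)])
  then have "uniform_limit K (\<lambda>N p. \<Prod>m<N. sigma_factor m p)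
      (\<lambda>p. lim (\<lambda>N. \<Prod>m<N. sigma_factor m p)) sequentially"
    by (simp add: uniformly_convergent_uniform_limit_iff)
  moreover have "lim (\<lambda>N. \<Prod>m<N. sigma_factor m p) = sigma_product p" if "p \<in> K" for p
    unfolding sigma_product_def using that assms
    by (intro limI has_prod_imp_tendsto' convergent_prod_has_prod convergent_sigma_product) auto
  ultimately show ?thesis by (simp cong: uniform_limit_cong')
qed

lemma continuous_sigma_product: "continuous_on half_plane_times_plane sigma_product"
  by (rule locally_uniform_limit_continuous[OF _ _ sigma_product_uniform_limit])
    (auto intro!: continuous_on_prod continuous_sigma_factor open_Times open_upper_half_plane)

lemma sigma_factor_field_differentiable:
  assumes "Im \<tau> > 0"
  shows "(\<lambda>t. sigma_factor m (t, z)) field_differentiable at \<tau>"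
    and "(\<lambda>t. sigma_factor m (\<tau>, t)) field_differentiable at z"
proof -
  note nz = nome_power_neq_1[OF assms, of m]
  show "(\<lambda>t. sigma_factor m (t, z)) field_differentiable at \<tau>"
    unfolding sigma_factor_def Let_def case_prod_conv field_differentiable_def
    by (rule exI) (rule derivative_eq_intros refl | simp add: nz del: power_Suc)+
  show "(\<lambda>t. sigma_factor m (\<tau>, t)) field_differentiable at z"
    unfolding sigma_factor_def Let_def case_prod_conv field_differentiable_def
    by (rule exI) (rule derivative_eq_intros refl | simp add: nz del: power_Suc)+
qed

lemma field_differentiable_prod_lessThan:
  assumes "\<And>m. f m field_differentiable at t"
  shows "(\<lambda>t. \<Prod>m<N::nat. f m t) field_differentiable at (t :: complex)"
  by (induction N) (simp_all add: assms field_differentiable_mult)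

lemma sigma_product_field_differentiable:
  assumes "Im \<tau> > 0"
  shows "(\<lambda>t. sigma_product (t, z)) field_differentiable at \<tau>"
    and "(\<lambda>t. sigma_product (\<tau>, t)) field_differentiable at z"
proof -
  have op: "open half_plane_times_plane" by (intro open_Times open_upper_half_plane open_UNIV)
  show "(\<lambda>t. sigma_product (t, z)) field_differentiable at \<tau>"
    by (rule locally_uniform_limit_slice[OF op _ _ sigma_product_uniform_limit])
      (use assms in \<open>auto intro!: continuous_intros field_differentiable_prod_lessThan sigma_factor_field_differentiable
         simp: upper_half_plane_def\<close>)
  show "(\<lambda>t. sigma_product (\<tau>, t)) field_differentiable at z"
    by (rule locally_uniform_limit_slice[OF op _ _ sigma_product_uniform_limit])
      (use assms in \<open>auto intro!: continuous_intros field_differentiable_prod_lessThan sigma_factor_field_differentiable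
         simp: upper_half_plane_def\<close>)
qed

section \<open>Quasi-periodicity and zeros of \<open>\<upsilon>\<close>\<close>

text \<open>The prefactor \<open>-y\<^bsup>1/2\<^esup>\<close> removes the half-integral powers of
\<open>y\<close>, so that \<open>\<upsilon>\<close> is periodic under integers without a sign.\<close>

lemma upsilon_eq: "upsilon \<tau> z = (1 - exp (2 * of_real pi * \<i> * z)) * sigma_product (\<tau>, z)"
proof -
  have "exp (of_real pi * \<i> * z) * exp (of_real pi * \<i> * z) = exp (2 * of_real pi * \<i> * z)"
    "exp (of_real pi * \<i> * z) * exp (- (of_real pi * \<i> * z)) = 1"
    by (simp_all add: mult_ac flip: exp_add)
  then have "- exp (of_real pi * \<i> * z) * (exp (of_real pi * \<i> * z) - exp (- (of_real pi * \<i> * z)))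
      = 1 - exp (2 * of_real pi * \<i> * z)" by (simp add: right_diff_distrib)
  then show ?thesis
    by (simp add: upsilon_def sigma_def sigma_product_def sigma_factor_def Let_def mult.assoc[symmetric])
qed

text \<open>Replacing \<open>y\<close> by \<open>qy\<close> shifts the index in both families of factors, so
the partial products telescope. The identity is kept free of denominators since the boundary
factors may vanish.\<close>

lemma sigma_product_shift:
  assumes "Im \<tau> > 0"
  shows "sigma_product (\<tau>, z + \<tau>) * (1 - exp (2 * of_real pi * \<i> * (z + \<tau>))) =
         sigma_product (\<tau>, z) * (1 - inverse (exp (2 * of_real pi * \<i> * z)))"
proof -
  define q where "q = exp (2 * of_real pi * \<i> * \<tau>)"
  define y where "y = exp (2 * of_real pi * \<i> * z)"
  have yq: "exp (2 * of_real pi * \<i> * (z + \<tau>)) = y * q" by (simp add: y_def q_def exp_add ring_distribs)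
  have nz: "y \<noteq> 0" "q \<noteq> 0" by (simp_all add: y_def q_def)
  let ?P = "\<lambda>N z. \<Prod>m<N. sigma_factor m (\<tau>, z)"
  have tele: "?P N (z + \<tau>) * ((1 - y * q) * (1 - q ^ N / y)) = ?P N z * ((1 - q ^ Suc N * y) * (1 - inverse y))" for N
  proof (induction N)
    case 0 then show ?case using nz by (simp add: field_simps)
  next
    case (Suc N)
    have f1: "sigma_factor N (\<tau>, z + \<tau>) = (1 - q ^ Suc (Suc N) * y) * (1 - q ^ N / y) / (1 - q ^ Suc N)\<^sup>2"
      unfolding sigma_factor_def Let_def case_prod_conv yq q_def[symmetric] using nz by (simp add: field_simps)
    have f2: "sigma_factor N (\<tau>, z) = (1 - q ^ Suc N * y) * (1 - q ^ Suc N / y) / (1 - q ^ Suc N)\<^sup>2"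
      unfolding sigma_factor_def Let_def case_prod_conv y_def[symmetric] q_def[symmetric] by (simp add: divide_inverse)
    have "?P (Suc N) (z + \<tau>) * ((1 - y * q) * (1 - q ^ Suc N / y)) =
      (?P N (z + \<tau>) * ((1 - y * q) * (1 - q ^ N / y))) * ((1 - q ^ Suc (Suc N) * y) * (1 - q ^ Suc N / y) / (1 - q ^ Suc N)\<^sup>2)"
      by (simp add: f1)
    also have "\<dots> = ?P (Suc N) z * ((1 - q ^ Suc (Suc N) * y) * (1 - inverse y))"
      unfolding Suc by (simp add: f2)
    finally show ?case .
  qed
  have lim: "(\<lambda>N. ?P N w) \<longlonglongrightarrow> sigma_product (\<tau>, w)" for w
    unfolding sigma_product_def using assms
    by (intro has_prod_imp_tendsto' convergent_prod_has_prod convergent_sigma_product)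
       (auto simp: upper_half_plane_def)
  have q0: "(\<lambda>N. q ^ N) \<longlonglongrightarrow> 0"
    using nome_norm_less_1[OF assms] unfolding q_def by (rule LIMSEQ_power_zero)
  have "(\<lambda>N. ?P N (z + \<tau>) * ((1 - y * q) * (1 - q ^ N / y))) \<longlonglongrightarrow>
      sigma_product (\<tau>, z + \<tau>) * ((1 - y * q) * (1 - 0 / y))"
    by (intro tendsto_intros lim q0) (use nz in auto)
  moreover have "(\<lambda>N. ?P N z * ((1 - q ^ Suc N * y) * (1 - inverse y))) \<longlonglongrightarrow>
      sigma_product (\<tau>, z) * ((1 - 0 * y) * (1 - inverse y))"
    by (intro tendsto_intros lim LIMSEQ_Suc[OF q0])
  ultimately have "sigma_product (\<tau>, z + \<tau>) * ((1 - y * q) * (1 - 0 / y)) =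
      sigma_product (\<tau>, z) * ((1 - 0 * y) * (1 - inverse y))"
    unfolding tele by (rule LIMSEQ_unique)
  then show ?thesis unfolding yq y_def[symmetric] by simp
qed

lemma exp_2pi_add_int:
  "exp (2 * of_real pi * \<i> * (z + of_int n)) = exp (2 * of_real pi * \<i> * z)"
  unfolding exp_eq by (intro exI[of _ n]) (simp add: algebra_simps)

lemma sigma_product_add_int: "sigma_product (\<tau>, z + of_int n) = sigma_product (\<tau>, z)"
proof -
  have "exp (2 * of_real pi * \<i> * (z + of_int n)) = exp (2 * of_real pi * \<i> * z)"
    by (rule exp_2pi_add_int)
  then show ?thesis by (simp add: sigma_product_def sigma_factor_def)
qed

lemma upsilon_add_int: "upsilon \<tau> (z + of_int n) = upsilon \<tau> z"
proof -
  have "exp (2 * of_real pi * \<i> * (z + of_int n)) = exp (2 * of_real pi * \<i> * z)"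
    by (rule exp_2pi_add_int)
  then show ?thesis by (simp add: upsilon_eq sigma_product_add_int)
qed

lemma upsilon_add_tau:
  assumes "Im \<tau> > 0"
  shows "upsilon \<tau> (z + \<tau>) = - exp (- (2 * of_real pi * \<i> * z)) * upsilon \<tau> z"
  using sigma_product_shift[OF assms, of z]
  by (simp add: upsilon_eq exp_minus field_simps)

lemma upsilon_add_nat_tau:
  assumes "Im \<tau> > 0"
  shows "upsilon \<tau> (z + of_nat k * \<tau>) =
    exp (of_real pi * \<i> * (- of_nat k * (1 - \<tau> + \<tau> * of_nat k + 2 * z))) * upsilon \<tau> z"
proof (induction k)
  case (Suc k)
  have "upsilon \<tau> (z + of_nat (Suc k) * \<tau>) = upsilon \<tau> ((z + of_nat k * \<tau>) + \<tau>)"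
    by (simp add: algebra_simps)
  also have "\<dots> = - exp (- (2 * of_real pi * \<i> * (z + of_nat k * \<tau>))) *
      (exp (of_real pi * \<i> * (- of_nat k * (1 - \<tau> + \<tau> * of_nat k + 2 * z))) * upsilon \<tau> z)"
    by (simp only: upsilon_add_tau[OF assms] Suc.IH)
  also have "- exp (- (2 * of_real pi * \<i> * (z + of_nat k * \<tau>))) =
      exp (- (of_real pi * \<i>)) * exp (- (2 * of_real pi * \<i> * (z + of_nat k * \<tau>)))"
    by (simp add: exp_minus)
  finally show ?case by (simp add: mult.assoc[symmetric] flip: exp_add) (simp add: algebra_simps)
qed simp

text \<open>The exponent is a polynomial of degree two in \<open>(m, z)\<close> without constant term, which
is why third differences, and with them the theta frame, do not see it.\<close>

lemma upsilon_lattice_shift: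
  assumes "Im \<tau> > 0"
  shows "upsilon \<tau> (z + of_int n - \<tau> * of_int m) =
    exp (of_real pi * \<i> * (of_int m * (1 - \<tau> - \<tau> * of_int m + 2 * z))) * upsilon \<tau> z"
proof -
  have "upsilon \<tau> (z - \<tau> * of_int m) =
    exp (of_real pi * \<i> * (of_int m * (1 - \<tau> - \<tau> * of_int m + 2 * z))) * upsilon \<tau> z"
  proof (cases "m \<ge> 0")
    case True
    then obtain k where k: "m = int k" using zero_le_imp_eq_int by blast
    define w where "w = z - \<tau> * of_nat k"
    have "upsilon \<tau> z = exp (of_real pi * \<i> * (- of_nat k * (1 - \<tau> + \<tau> * of_nat k + 2 * w))) * upsilon \<tau> w"
      using upsilon_add_nat_tau[OF assms, of w k] by (simp add: w_def mult.commute)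
    then have "exp (of_real pi * \<i> * (of_int m * (1 - \<tau> - \<tau> * of_int m + 2 * z))) * upsilon \<tau> z =
      exp (of_real pi * \<i> * (of_int m * (1 - \<tau> - \<tau> * of_int m + 2 * z)) +
         of_real pi * \<i> * (- of_nat k * (1 - \<tau> + \<tau> * of_nat k + 2 * w))) * upsilon \<tau> w"
      by (simp only: exp_add mult.assoc)
    also have "of_real pi * \<i> * (of_int m * (1 - \<tau> - \<tau> * of_int m + 2 * z)) +
         of_real pi * \<i> * (- of_nat k * (1 - \<tau> + \<tau> * of_nat k + 2 * w)) = 0"
      unfolding k w_def by (simp add: algebra_simps)
    finally show ?thesis unfolding k w_def by simp
  next
    case False
    then obtain k where k: "m = - int k" by (metis int_cases linear neg_0_le_iff_le nonneg_int_cases add.inverse_inverse)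
    show ?thesis using upsilon_add_nat_tau[OF assms, of z k]
      unfolding k by (simp add: algebra_simps)
  qed
  moreover have "z + of_int n - \<tau> * of_int m = (z - \<tau> * of_int m) + of_int n" by simp
  ultimately show ?thesis by (simp only: upsilon_add_int)
qed

lemma exp_2pi_i_eq_1:
  assumes "exp (2 * of_real pi * \<i> * w) = 1"
  obtains n :: int where "w = of_int n"
proof -
  obtain n :: int where n: "Re w * 2 * pi = of_int (2 * n) * pi" "Im w = 0"
    using assms unfolding exp_eq_1 by auto
  then have "w = of_int n" by (auto simp: complex_eq_iff)
  then show ?thesis by (rule that)
qed

lemma upsilon_zero: "upsilon \<tau> 0 = 0" by (simp add: upsilon_eq)

text \<open>Quasi-periodicity moves every lattice point to \<open>0\<close>; conversely a convergent
infinite product vanishes only if one of its factors does.\<close>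

lemma upsilon_eq_0_iff:
  assumes "Im \<tau> > 0"
  shows "upsilon \<tau> z = 0 \<longleftrightarrow> z \<in> period_lattice \<tau>"
proof
  assume "z \<in> period_lattice \<tau>"
  then obtain n m :: int where "z = 0 + of_int n - \<tau> * of_int m" by (auto simp: period_lattice_def)
  then show "upsilon \<tau> z = 0" using upsilon_lattice_shift[OF assms, of 0 n m] by (simp add: upsilon_zero)
next
  assume "upsilon \<tau> z = 0"
  then consider "exp (2 * of_real pi * \<i> * z) = 1" | "sigma_product (\<tau>, z) = 0"
    by (auto simp: upsilon_eq)
  then show "z \<in> period_lattice \<tau>"
  proof cases
    case 1
    then obtain n :: int where "z = of_int n" by (rule exp_2pi_i_eq_1)
    then have "z = of_int n - \<tau> * of_int 0" by simp
    then show ?thesis unfolding period_lattice_def by blast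
  next
    case 2
    have "convergent_prod (\<lambda>m. sigma_factor m (\<tau>, z))"
      using assms by (intro convergent_sigma_product) (simp add: upper_half_plane_def)
    with 2 obtain m where "sigma_factor m (\<tau>, z) = 0"
      unfolding sigma_product_def using prodinf_nonzero by blast
    then consider "exp (2 * of_real pi * \<i> * \<tau>) ^ Suc m * exp (2 * of_real pi * \<i> * z) = 1"
      | "exp (2 * of_real pi * \<i> * \<tau>) ^ Suc m * inverse (exp (2 * of_real pi * \<i> * z)) = 1"
      using nome_power_neq_1[OF assms, of m] by (auto simp: sigma_factor_def Let_def simp del: power_Suc)
    then show ?thesis
    proof cases
      case 1
      then have "exp (2 * of_real pi * \<i> * (of_nat (Suc m) * \<tau> + z)) = 1"
        unfolding exp_of_nat_mult[symmetric] exp_add[symmetric] by (simp add: algebra_simps)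
      then obtain n :: int where "of_nat (Suc m) * \<tau> + z = of_int n" by (rule exp_2pi_i_eq_1)
      then have "z = of_int n - \<tau> * of_int (int (Suc m))" by (simp add: algebra_simps)
      then show ?thesis unfolding period_lattice_def by blast
    next
      case 2
      then have "exp (2 * of_real pi * \<i> * (of_nat (Suc m) * \<tau> - z)) = 1"
        unfolding exp_of_nat_mult[symmetric] exp_minus[symmetric] exp_add[symmetric] by (simp add: algebra_simps)
      then obtain n :: int where "of_nat (Suc m) * \<tau> - z = of_int n" by (rule exp_2pi_i_eq_1)
      then have "z = of_int (- n) - \<tau> * of_int (- int (Suc m))" by (simp add: algebra_simps)
      then show ?thesis unfolding period_lattice_def by blast
    qed
  qed
qed

lemma upsilon_field_differentiable:
  assumes "Im \<tau> > 0"
  shows "(\<lambda>t. upsilon t z) field_differentiable at \<tau>" and "upsilon \<tau> field_differentiable at z"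
proof -
  have "upsilon \<tau> = (\<lambda>z. (1 - exp (2 * of_real pi * \<i> * z)) * sigma_product (\<tau>, z))"
    by (simp add: upsilon_eq fun_eq_iff)
  moreover have "(\<lambda>z. 1 - exp (2 * of_real pi * \<i> * z)) field_differentiable at z"
    unfolding field_differentiable_def by (rule exI) (rule derivative_eq_intros refl)+
  ultimately show "upsilon \<tau> field_differentiable at z"
    using field_differentiable_mult sigma_product_field_differentiable(2)[OF assms, of z] by simp
  show "(\<lambda>t. upsilon t z) field_differentiable at \<tau>"
    unfolding upsilon_eq
    using sigma_product_field_differentiable(1)[OF assms, of z]
    by (intro field_differentiable_mult) auto
qed

lemma upsilon_has_derivative_at_0:
  assumes "Im \<tau> > 0"
  shows "(upsilon \<tau> has_field_derivative - 2 * of_real pi * \<i>) (at 0)"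
proof -
  have "sigma_factor m (\<tau>, 0) = 1" for m
    using nome_power_neq_1[OF assms, of m]
    by (simp add: sigma_factor_def Let_def power2_eq_square del: power_Suc)
  then have "sigma_product (\<tau>, 0) = 1" by (simp add: sigma_product_def)
  obtain D where D: "((\<lambda>t. sigma_product (\<tau>, t)) has_field_derivative D) (at 0)"
    using sigma_product_field_differentiable(2)[OF assms] by (auto simp: field_differentiable_def)
  have eq: "upsilon \<tau> = (\<lambda>z. (1 - exp (2 * of_real pi * \<i> * z)) * sigma_product (\<tau>, z))"
    by (simp add: upsilon_eq fun_eq_iff)
  show ?thesis unfolding eq
    by (rule derivative_eq_intros D refl | simp add: \<open>sigma_product (\<tau>, 0) = 1\<close>)+
qed

lemma deriv_upsilon_0: "Im \<tau> > 0 \<Longrightarrow> deriv (upsilon \<tau>) 0 = - 2 * of_real pi * \<i>"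
  by (rule DERIV_imp_deriv[OF upsilon_has_derivative_at_0])

lemma upsilon_simple_zero:
  assumes "Im \<tau> > 0" "z \<in> period_lattice \<tau>"
  shows "deriv (upsilon \<tau>) z \<noteq> 0"
proof -
  obtain n m :: int where z: "z = of_int n - \<tau> * of_int m" using assms by (auto simp: period_lattice_def)
  define M where "M = (\<lambda>w. exp (of_real pi * \<i> * (of_int m * (1 - \<tau> - \<tau> * of_int m + 2 * w))))"
  have "upsilon \<tau> w = M (w - z) * upsilon \<tau> (w - z)" for w
    using upsilon_lattice_shift[OF assms(1), of "w - z" n m] by (simp add: z M_def)
  then have eq: "upsilon \<tau> = (\<lambda>w. M (w - z) * upsilon \<tau> (w - z))" by (rule ext)
  have D0: "(upsilon \<tau> has_field_derivative - 2 * of_real pi * \<i>) (at (z - z))"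
    using upsilon_has_derivative_at_0[OF assms(1)] by (simp only: diff_self)
  have shift: "((\<lambda>w. upsilon \<tau> (w - z)) has_field_derivative (- 2 * of_real pi * \<i>)) (at z)"
    using DERIV_shift[of "upsilon \<tau>" "- 2 * of_real pi * \<i>" "z" "- z"] D0 by simp
  have "\<exists>M'. ((\<lambda>w. M (w - z)) has_field_derivative M') (at z)"
    unfolding M_def by (rule exI) (rule derivative_eq_intros refl)+
  then obtain M' where M': "((\<lambda>w. M (w - z)) has_field_derivative M') (at z)" by blast
  have "((\<lambda>w. M (w - z) * upsilon \<tau> (w - z)) has_field_derivative M (z - z) * (- 2 * of_real pi * \<i>)) (at z)"
    using DERIV_mult[OF M' shift] by (simp add: upsilon_zero mult_ac)
  then have "deriv (upsilon \<tau>) z = M 0 * (- 2 * of_real pi * \<i>)"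
    by (subst eq) (simp add: DERIV_imp_deriv)
  then show ?thesis by (simp add: M_def)
qed

section \<open>Lattice translations of the theta frame\<close>

lemma period_lattice_shift_iff:
  "w + of_int n - \<tau> * of_int m \<in> period_lattice \<tau> \<longleftrightarrow> w \<in> period_lattice \<tau>"
proof
  assume "w + of_int n - \<tau> * of_int m \<in> period_lattice \<tau>"
  then obtain n' m' :: int where "w + of_int n - \<tau> * of_int m = of_int n' - \<tau> * of_int m'"
    by (auto simp: period_lattice_def)
  then have "w = of_int (n' - n) - \<tau> * of_int (m' - m)" by (simp add: algebra_simps)
  then show "w \<in> period_lattice \<tau>" unfolding period_lattice_def by blast
next
  assume "w \<in> period_lattice \<tau>"
  then obtain n' m' :: int where "w = of_int n' - \<tau> * of_int m'"
    by (auto simp: period_lattice_def)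
  then have "w + of_int n - \<tau> * of_int m = of_int (n' + n) - \<tau> * of_int (m' + m)"
    by (simp add: algebra_simps)
  then show "w + of_int n - \<tau> * of_int m \<in> period_lattice \<tau>" unfolding period_lattice_def by blast
qed

lemma countable_period_lattice: "countable (period_lattice \<tau>)"
proof -
  have "period_lattice \<tau> = (\<lambda>(n::int, m::int). of_int n - \<tau> * of_int m) ` UNIV"
    by (auto simp: period_lattice_def)
  then show ?thesis by simp
qed

lemma off_divisors_iff:
  "(\<tau>, v) \<in> off_divisors U \<longleftrightarrow> \<tau> \<in> U \<and>
     v$1 + v$2 + v$3 \<notin> period_lattice \<tau> \<and> v$1 \<notin> period_lattice \<tau> \<and> v$2 \<notin> period_lattice \<tau> \<and>
     v$3 \<notin> period_lattice \<tau> \<and> v$1 + v$2 \<notin> period_lattice \<tau> \<and> v$1 + v$3 \<notin> period_lattice \<tau> \<and>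
     v$2 + v$3 \<notin> period_lattice \<tau>"
  unfolding off_divisors_def by auto

lemma add_lattice_shifts:
  "(a + of_int n - \<tau> * of_int m) + (b + of_int n' - \<tau> * of_int m') =
    (a + b) + of_int (n + n') - \<tau> * (of_int (m + m') :: complex)"
  by (simp add: algebra_simps)

lemma off_divisors_shift_iff:
  "(\<tau>, \<chi> i. v $ i + of_int (n $ i) - \<tau> * of_int (m $ i)) \<in> off_divisors U \<longleftrightarrow> (\<tau>, v) \<in> off_divisors U"
proof -
  show ?thesis unfolding off_divisors_iff vec_lambda_beta add_lattice_shifts period_lattice_shift_iff ..
qed

section \<open>Doubly periodic entire functions and quotients of entire functions\<close>

lemma closure_complement_countable:
  assumes "countable (C :: complex set)" shows "closure (- C) = UNIV"
proof -
  have "interior C = {}"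
  proof (rule ccontr)
    assume "interior C \<noteq> {}"
    then obtain x e where "e > 0" "ball x e \<subseteq> C" by (meson all_not_in_conv mem_interior)
    then show False using assms countable_subset uncountable_ball by blast
  qed
  then show ?thesis by (simp add: closure_complement)
qed

text \<open>The relations between sections are known only off the divisors, which meet a line in a countable
set; continuity extends periodicity across it.\<close>

lemma periodic_off_countable:
  assumes "f holomorphic_on UNIV" "countable C" "\<And>t. t \<notin> C \<Longrightarrow> f (t + p) = f t"
  shows "f (t + p) = f (t :: complex)"
proof -
  have cont: "continuous_on UNIV f" using assms(1) by (rule holomorphic_on_imp_continuous_on)
  have "continuous_on UNIV (\<lambda>t. f (t + p) - f t)"
    by (intro continuous_intros continuous_on_compose2[OF cont]) auto
  then have "closed {t. f (t + p) - f t = 0}" by (rule continuous_closed_preimage_constant[of UNIV, simplified])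
  moreover have "- C \<subseteq> {t. f (t + p) - f t = 0}" using assms(3) by auto
  ultimately have "closure (- C) \<subseteq> {t. f (t + p) - f t = 0}" by (rule closure_minimal[rotated])
  then show ?thesis unfolding closure_complement_countable[OF assms(2)] by auto
qed

lemma periodic_int_multiple:
  assumes "\<And>t. f (t + p) = f (t :: complex)" shows "f (t + of_int n * p) = f t"
proof -
  have *: "f (t + of_nat k * p) = f t" for k t
  proof (induction k)
    case (Suc k)
    have "t + of_nat (Suc k) * p = (t + of_nat k * p) + p" by (simp add: algebra_simps)
    then show ?case using assms Suc by metis
  qed simp
  show ?thesis
  proof (cases "n \<ge> 0")
    case True then show ?thesis using *[of t "nat n"] by simp
  next
    case False then show ?thesis using *[of "t + of_int n * p" "nat (- n)"] by simp
  qed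
qed

lemma doubly_periodic_entire_constant:
  assumes "Im \<tau> > 0" "f holomorphic_on UNIV" "countable C"
    and "\<And>t. t \<notin> C \<Longrightarrow> f (t + 1) = f t" "\<And>t. t \<notin> C \<Longrightarrow> f (t - \<tau>) = f t"
  shows "f t = f 0"
proof -
  have per: "f (t + of_int n * 1) = f t" "f (t + of_int n * (- \<tau>)) = f t" for t n
    using periodic_off_countable[OF assms(2,3), of 1] periodic_off_countable[OF assms(2,3), of "- \<tau>"] assms(4,5)
    by (intro periodic_int_multiple; simp)+
  \<comment> \<open>Periodicity reduces every point to the closed fundamental parallelogram, which is compact.\<close>
  let ?P = "(\<lambda>(a, b). of_real a + of_real b * \<tau>) ` ({0..1::real} \<times> {0..1::real})"
  have "range f \<subseteq> f ` ?P"
  proof (rule image_subsetI)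
    fix t
    define b where "b = Im t / Im \<tau>"
    define a where "a = Re (t - of_real b * \<tau>)"
    have t: "t = of_real a + of_real b * \<tau>"
      using assms(1) by (simp add: complex_eq_iff a_def b_def)
    have "of_real (frac a) + of_real (frac b) * \<tau> =
        (t + of_int (- \<lfloor>a\<rfloor>) * 1) + of_int \<lfloor>b\<rfloor> * (- \<tau>)"
      unfolding t frac_def by (simp add: algebra_simps)
    then have "f t = f (of_real (frac a) + of_real (frac b) * \<tau>)" by (simp only: per)
    then show "f t \<in> f ` ?P"
      by (auto intro!: image_eqI[of _ _ "(frac a, frac b)"] imageI simp: less_imp_le[OF frac_lt_1])
  qed
  moreover have "compact ({0..1::real} \<times> {0..1::real})" by (intro compact_Times compact_Icc)
  then have "compact ?P"
    unfolding case_prod_unfold by (rule compact_continuous_image[rotated]) (intro continuous_intros)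
  then have "bounded (f ` ?P)"
    by (rule compact_imp_bounded[OF compact_continuous_image[OF
        continuous_on_subset[OF holomorphic_on_imp_continuous_on[OF assms(2)] subset_UNIV]]])
  ultimately have "f constant_on UNIV"
    using Liouville_theorem[OF assms(2)] bounded_subset by blast
  then show ?thesis by (metis constant_on_def UNIV_I)
qed

text \<open>At a common simple zero the quotient extends by the quotient of the derivatives. Applied to a
frame and \<open>\<upsilon>\<close>, this says that frames differ by units.\<close>

lemma entire_quotient_simple_zeros:
  assumes f: "f holomorphic_on UNIV" and h: "h holomorphic_on UNIV"
    and zeros: "\<And>z. f z = 0 \<longleftrightarrow> h z = 0"
    and simple: "\<And>z. h z = 0 \<Longrightarrow> deriv f z \<noteq> 0" "\<And>z. h z = 0 \<Longrightarrow> deriv h z \<noteq> (0::complex)"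
  obtains g where "g holomorphic_on UNIV" "\<And>z. g z \<noteq> 0" "\<And>z. f z = g z * h z"
proof -
  define g where "g z = (if h z = 0 then deriv f z / deriv h z else f z / h z)" for z
  have df: "(f has_field_derivative deriv f z) (at z)" and dh: "(h has_field_derivative deriv h z) (at z)" for z
    using f h by (auto intro: holomorphic_derivI[OF _ open_UNIV])
  have "g field_differentiable at z" for z
  proof (cases "h z = 0")
    case False
    define A where "A = {w. h w \<noteq> 0}"
    have "open A" unfolding A_def
      using holomorphic_on_imp_continuous_on[OF h] by (intro open_Collect_neq continuous_intros) auto
    have "(\<lambda>w. f w / h w) holomorphic_on A"
      using f h by (intro holomorphic_intros) (auto intro: holomorphic_on_subset simp: A_def)
    then have "g holomorphic_on A" by (rule holomorphic_transform) (simp add: A_def g_def)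
    then show ?thesis using \<open>open A\<close> False by (auto simp: A_def intro: holomorphic_on_imp_differentiable_at)
  next
    case True
    have "((\<lambda>w. (h w - h z) / (w - z)) \<longlongrightarrow> deriv h z) (at z)"
      using dh by (simp add: has_field_derivative_iff)
    then have "\<forall>\<^sub>F w in at z. (h w - h z) / (w - z) \<noteq> 0"
      using simple(2)[OF True] by (rule tendsto_imp_eventually_ne)
    then have "\<forall>\<^sub>F w in at z. h w \<noteq> 0" by eventually_elim (use True in auto)
    then obtain S where S: "open S" "z \<in> S" "\<And>w. w \<in> S \<Longrightarrow> w \<noteq> z \<Longrightarrow> h w \<noteq> 0"
      unfolding eventually_at_topological by blast
    \<comment> \<open>The zero of \<open>h\<close> at \<open>z\<close> is isolated, so the singularity of the quotient is removable.\<close>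
    have lim: "(\<lambda>w. f w / h w) \<midarrow>z\<rightarrow> deriv f z / deriv h z"
      using df dh True zeros simple by (intro lhopital_complex_simple) auto
    have "(\<lambda>w. f w / h w) holomorphic_on S - {z}"
      using f h S by (intro holomorphic_intros) (auto intro: holomorphic_on_subset)
    then have "(\<lambda>w. if w = z then deriv f z / deriv h z else f w / h w) holomorphic_on S"
      using lim by (rule removable_singularity[OF _ S(1)])
    then have "g holomorphic_on S" by (rule holomorphic_transform) (use S True in \<open>auto simp: g_def\<close>)
    then show ?thesis using S by (auto intro: holomorphic_on_imp_differentiable_at)
  qed
  then have "g holomorphic_on UNIV" by (simp add: holomorphic_on_def field_differentiable_at_within)
  moreover have "g z \<noteq> 0" "f z = g z * h z" for z using zeros simple by (auto simp: g_def)
  ultimately show ?thesis by (rule that)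
qed

lemma theta3_frame_upsilon_nonzero:
  assumes "p \<in> off_divisors U" "U \<subseteq> upper_half_plane"
  shows "theta3_frame upsilon p \<noteq> 0"
proof -
  obtain \<tau> v where p: "p = (\<tau>, v)" by (cases p)
  then have "Im \<tau> > 0" using assms by (auto simp: off_divisors_iff upper_half_plane_def)
  then show ?thesis using assms(1)
    by (simp add: p theta3_frame_def off_divisors_iff upsilon_eq_0_iff deriv_upsilon_0)
qed

text \<open>The four numerator factors of automorphy cancel against the three in the denominator, because
the third difference of a quadratic polynomial without constant term is zero.\<close>

lemma theta3_frame_upsilon_shift:
  assumes "Im \<tau> > 0"
  shows "theta3_frame upsilon (\<tau>, \<chi> i. v $ i + of_int (n $ i) - \<tau> * of_int (m $ i)) = theta3_frame upsilon (\<tau>, v)"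
proof -
  define e where "e k w = exp (of_real pi * \<i> * (of_int k * (1 - \<tau> - \<tau> * of_int k + 2 * w)))" for k w
  have shift: "upsilon \<tau> (z + of_int n - \<tau> * of_int m) = e m z * upsilon \<tau> z" for z n m
    unfolding e_def by (rule upsilon_lattice_shift[OF assms])
  have cube: "e (m$1 + m$2 + m$3) (v$1 + v$2 + v$3) * e (m$1) (v$1) * e (m$2) (v$2) * e (m$3) (v$3) =
      e (m$1 + m$2) (v$1 + v$2) * e (m$1 + m$3) (v$1 + v$3) * e (m$2 + m$3) (v$2 + v$3)"
    unfolding e_def by (simp only: exp_add[symmetric], rule arg_cong[of _ _ exp]) (simp add: algebra_simps)
  have nz: "e k w \<noteq> 0" for k w by (simp add: e_def)
  have "theta3_frame upsilon (\<tau>, \<chi> i. v $ i + of_int (n $ i) - \<tau> * of_int (m $ i)) =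
     (e (m$1 + m$2 + m$3) (v$1 + v$2 + v$3) * e (m$1) (v$1) * e (m$2) (v$2) * e (m$3) (v$3)) /
     (e (m$1 + m$2) (v$1 + v$2) * e (m$1 + m$3) (v$1 + v$3) * e (m$2 + m$3) (v$2 + v$3)) *
     theta3_frame upsilon (\<tau>, v)"
    unfolding theta3_frame_def case_prod_conv vec_lambda_beta add_lattice_shifts shift by (simp only: times_divide_times_eq mult_ac)
  also have "\<dots> = theta3_frame upsilon (\<tau>, v)" unfolding cube using nz by simp
  finally show ?thesis .
qed

section \<open>Rigidity of sections of \<open>\<Theta>\<^sup>3(O(-0))\<close>\<close>

text \<open>The theta frame of a unit \<open>g\<close>: here the last factor is the value \<open>g
0\<close>, because the first derivative at \<open>0\<close> of \<open>g l\<close> is \<open>g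
0\<close> times that of \<open>l\<close> when \<open>l\<close> vanishes at \<open>0\<close>.\<close>

definition cube :: "(complex \<Rightarrow> complex) \<Rightarrow> complex ^ 3 \<Rightarrow> complex" where
  "cube g v = (g (v$1 + v$2 + v$3) * g (v$1) * g (v$2) * g (v$3)) /
     (g (v$1 + v$2) * g (v$1 + v$3) * g (v$2 + v$3) * g 0)"

lemma theta3_frame_change:
  assumes l: "\<And>z. l \<tau> z = g z * k \<tau> z" and "g holomorphic_on UNIV"
    and "k \<tau> field_differentiable at 0" "k \<tau> 0 = 0"
  shows "theta3_frame l (\<tau>, v) = cube g v * theta3_frame k (\<tau>, v)"
proof -
  have "(g has_field_derivative deriv g 0) (at 0)"
    using assms(2) by (auto intro: holomorphic_derivI[OF _ open_UNIV])
  moreover have "(k \<tau> has_field_derivative deriv (k \<tau>) 0) (at 0)"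
    using assms(3) by (rule field_differentiable_derivI)
  ultimately have "((\<lambda>z. g z * k \<tau> z) has_field_derivative deriv g 0 * k \<tau> 0 + deriv (k \<tau>) 0 * g 0) (at 0)"
    by (rule DERIV_mult)
  moreover have "l \<tau> = (\<lambda>z. g z * k \<tau> z)" using l by (rule ext)
  ultimately have "deriv (l \<tau>) 0 = g 0 * deriv (k \<tau>) 0"
    using assms(4) by (simp add: DERIV_imp_deriv)
  then show ?thesis
    by (simp only: theta3_frame_def cube_def case_prod_conv l times_divide_times_eq mult_ac)
qed

lemma cube_nonzero: "(\<And>z. g z \<noteq> 0) \<Longrightarrow> cube g v \<noteq> 0"
  by (simp add: cube_def)

lemma cube_holomorphic_on_lines:
  assumes "g holomorphic_on UNIV" "\<And>z. g z \<noteq> 0"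
  shows "(\<lambda>t. cube g (a + t *s b)) holomorphic_on UNIV"
proof -
  have comp: "(\<lambda>t. g (f t)) holomorphic_on UNIV" if "f holomorphic_on UNIV" for f
    using holomorphic_on_compose_gen[OF that assms(1)] by (simp add: o_def)
  show ?thesis
    unfolding cube_def vector_add_component vector_smult_component
    by (intro holomorphic_intros comp) (auto simp: assms(2))
qed

lemma vector_3_axes:
  "(vector [t, y, z] :: complex ^ 3) = vector [0, y, z] + t *s axis 1 1"
  "(vector [x, t, z] :: complex ^ 3) = vector [x, 0, z] + t *s axis 2 1"
  "(vector [x, y, t] :: complex ^ 3) = vector [x, y, 0] + t *s axis 3 1"
  unfolding vec_eq_iff forall_3 vector_add_component vector_smult_component vector_3 axis_def vec_lambda_beta
  by simp_all

lemma vector_3_eta: "vector [v$1, v$2, v$3] = (v :: 'a::zero ^ 3)"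
  by (simp add: vec_eq_iff forall_3)

text \<open>A generic auxiliary point: it lets relations that hold off the divisors be used for points on
them.\<close>

lemma not_in_lattice_translates:
  assumes "countable (S :: complex set)"
  obtains x where "\<And>w. w \<in> S \<Longrightarrow> x + w \<notin> period_lattice \<tau>"
proof -
  have "countable (\<Union>w\<in>S. (\<lambda>u. u - w) ` period_lattice \<tau>)"
    using assms countable_period_lattice by auto
  then obtain x where "x \<notin> (\<Union>w\<in>S. (\<lambda>u. u - w) ` period_lattice \<tau>)"
    using uncountable_UNIV_complex by (metis UNIV_eq_I)
  then have "x + w \<notin> period_lattice \<tau>" if "w \<in> S" for w
    using that by (metis UN_I add_diff_cancel_right' image_eqI)
  then show ?thesis by (rule that)
qed

text \<open>The function is invariant only off the divisors, so the coordinates are set to zero one at a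
time. For generic \<open>y, z\<close> the function of \<open>x\<close> is doubly periodic and
entire, hence constant; thus \<open>H(x, y, z) = H(0, y, z)\<close>. This equation, read
backwards with a generic \<open>x\<close>, gives \<open>H(0, y, z)\<close> the periods in
\<open>y\<close>, and likewise for \<open>z\<close>.\<close>

lemma lattice_invariant_constant:
  fixes H :: "complex ^ 3 \<Rightarrow> complex"
  assumes \<tau>: "Im \<tau> > 0" "\<tau> \<in> U"
    and hol: "\<And>a b. (\<lambda>t. H (a + t *s b)) holomorphic_on UNIV"
    and inv: "\<And>v n m. (\<tau>, v) \<in> off_divisors U \<Longrightarrow>
        H (\<chi> i. v $ i + of_int (n $ i) - \<tau> * of_int (m $ i)) = H v"
    and "(\<tau>, v) \<in> off_divisors U"
  shows "H v = H 0"
proof -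
  let ?L = "period_lattice \<tau>"
  define h where "h x y z = H (vector [x, y, z])" for x y z
  have hol1: "(\<lambda>t. h t y z) holomorphic_on UNIV" for y z
    using hol[of "vector [0, y, z]" "axis 1 1"] unfolding h_def by (simp only: vector_3_axes(1)[symmetric])
  have hol2: "(\<lambda>t. h x t z) holomorphic_on UNIV" for x z
    using hol[of "vector [x, 0, z]" "axis 2 1"] unfolding h_def by (simp only: vector_3_axes(2)[symmetric])
  have hol3: "(\<lambda>t. h x y t) holomorphic_on UNIV" for x y
    using hol[of "vector [x, y, 0]" "axis 3 1"] unfolding h_def by (simp only: vector_3_axes(3)[symmetric])
  define off where "off x y z \<longleftrightarrow> x + y + z \<notin> ?L \<and> x \<notin> ?L \<and> y \<notin> ?L \<and> z \<notin> ?L \<and>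
      x + y \<notin> ?L \<and> x + z \<notin> ?L \<and> y + z \<notin> ?L" for x y z
  have off_iff: "off x y z \<longleftrightarrow> (\<tau>, vector [x, y, z]) \<in> off_divisors U" for x y z
    using \<tau> by (simp add: off_def off_divisors_iff)
  have shift: "h (x + of_int n1 - \<tau> * of_int m1) (y + of_int n2 - \<tau> * of_int m2) (z + of_int n3 - \<tau> * of_int m3)
      = h x y z" if "off x y z" for x y z and n1 m1 n2 m2 n3 m3 :: int
  proof -
    have "(\<chi> i. vector [x, y, z] $ i + of_int (vector [n1, n2, n3] $ i) - \<tau> * of_int (vector [m1, m2, m3] $ i)) =
       (vector [x + of_int n1 - \<tau> * of_int m1, y + of_int n2 - \<tau> * of_int m2, z + of_int n3 - \<tau> * of_int m3] :: complex ^ 3)"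
      by (simp add: vec_eq_iff forall_3)
    then show ?thesis using inv[of "vector [x, y, z]" "vector [n1, n2, n3]" "vector [m1, m2, m3]"] that
      by (simp only: h_def off_iff)
  qed
  have L1: "w + 1 \<in> ?L \<longleftrightarrow> w \<in> ?L" "w - \<tau> \<in> ?L \<longleftrightarrow> w \<in> ?L" for w
    using period_lattice_shift_iff[of w 1 \<tau> 0] period_lattice_shift_iff[of w 0 \<tau> 1] by auto
  have cnt: "countable {t. t + w \<in> ?L}" for w
  proof -
    have "{t. t + w \<in> ?L} = (\<lambda>u. u - w) ` ?L" by (force simp: image_iff)
    then show ?thesis using countable_period_lattice by simp
  qed
  have x_const: "h x y z = h 0 y z" if "y \<notin> ?L" "z \<notin> ?L" "y + z \<notin> ?L" for x y z
  proof (rule doubly_periodic_entire_constant[OF \<tau>(1) hol1])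
    let ?C = "{t. t + 0 \<in> ?L} \<union> {t. t + y \<in> ?L} \<union> {t. t + z \<in> ?L} \<union> {t. t + (y + z) \<in> ?L}"
    show "countable ?C" by (intro countable_Un cnt)
    fix t assume "t \<notin> ?C"
    then have "off t y z" using that by (simp add: off_def add.assoc)
    then show "h (t + 1) y z = h t y z" "h (t - \<tau>) y z = h t y z"
      using shift[of t y z 1 0 0 0 0 0] shift[of t y z 0 1 0 0 0 0] by simp_all
  qed
  have y_const: "h 0 y z = h 0 0 z" if "z \<notin> ?L" for y z
  proof (rule doubly_periodic_entire_constant[OF \<tau>(1) hol2])
    let ?C = "{t. t + 0 \<in> ?L} \<union> {t. t + z \<in> ?L}"
    show "countable ?C" by (intro countable_Un cnt)
    fix t assume t: "t \<notin> ?C"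
    obtain x where x: "\<And>w. w \<in> {0, t, z, t + z} \<Longrightarrow> x + w \<notin> ?L"
      using not_in_lattice_translates[of "{0, t, z, t + z}" \<tau>] by auto
    have off: "off x t z" using x[of 0] x[of t] x[of z] x[of "t + z"] that t
      by (auto simp: off_def add.assoc)
    have "h 0 (t + 1) z = h x (t + 1) z" "h 0 (t - \<tau>) z = h x (t - \<tau>) z" "h 0 t z = h x t z"
      using x_const[of "t + 1" z x] x_const[of "t - \<tau>" z x] x_const[of t z x] that t
        L1[of t] L1[of "t + z"] by (simp_all add: algebra_simps)
    then show "h 0 (t + 1) z = h 0 t z" "h 0 (t - \<tau>) z = h 0 t z"
      using shift[OF off, of 0 0 1 0 0 0] shift[OF off, of 0 0 0 1 0 0] by simp_all
  qed
  have z_const: "h 0 0 z = h 0 0 0" for z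
  proof (rule doubly_periodic_entire_constant[OF \<tau>(1) hol3])
    show "countable ?L" by (rule countable_period_lattice)
    fix t assume t: "t \<notin> ?L"
    obtain y where y: "\<And>w. w \<in> {0, t} \<Longrightarrow> y + w \<notin> ?L"
      using not_in_lattice_translates[of "{0, t}" \<tau>] by auto
    obtain x where x: "\<And>w. w \<in> {0, y, t, y + t} \<Longrightarrow> x + w \<notin> ?L"
      using not_in_lattice_translates[of "{0, y, t, y + t}" \<tau>] by auto
    have off: "off x y t" using x[of 0] x[of y] x[of t] x[of "y + t"] y[of 0] y[of t] t
      by (auto simp: off_def add.assoc)
    have "h 0 0 u = h x y u" if "u \<notin> ?L" "y + u \<notin> ?L" for u
      using y_const[OF that(1), of y] x_const[of y u x] that y[of 0] by simp
    from this[of t] this[of "t + 1"] this[of "t - \<tau>"]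
    have "h 0 0 t = h x y t" "h 0 0 (t + 1) = h x y (t + 1)" "h 0 0 (t - \<tau>) = h x y (t - \<tau>)"
      using y[of t] t L1[of t] L1[of "y + t"] by (simp_all add: algebra_simps)
    then show "h 0 0 (t + 1) = h 0 0 t" "h 0 0 (t - \<tau>) = h 0 0 t"
      using shift[OF off, of 0 0 0 0 1 0] shift[OF off, of 0 0 0 0 0 1] by simp_all
  qed
  have "off (v$1) (v$2) (v$3)" using assms(5) by (simp only: off_iff vector_3_eta)
  then have "h (v$1) (v$2) (v$3) = h 0 0 0"
    using x_const[of "v$2" "v$3" "v$1"] y_const[of "v$3" "v$2"] z_const[of "v$3"] by (simp add: off_def)
  moreover have "vector [0, 0, 0] = (0 :: complex ^ 3)" using vector_3_eta[of "0 :: complex ^ 3"] by simp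
  ultimately show ?thesis by (simp only: h_def vector_3_eta)
qed

lemma upsilon_entire: "Im \<tau> > 0 \<Longrightarrow> upsilon \<tau> holomorphic_on UNIV"
  by (simp add: holomorphic_on_def field_differentiable_at_within upsilon_field_differentiable)

text \<open>Both factors of \<open>s\<close> are rewritten in terms of \<open>\<upsilon>\<close>: the unit
relating \<open>l\<close> to \<open>\<upsilon>\<close> goes into the holomorphic coordinate,
which is then lattice-invariant and so constant. The statement concerns a single
\<open>\<tau>\<close>, so it serves for frames over \<open>U\<close> and also for one function
transported along a modular transformation.\<close>

lemma theta3_rigidity:
  assumes \<tau>: "\<tau> \<in> U" "U \<subseteq> upper_half_plane" and \<epsilon>: "\<epsilon> \<in> {1, -1 :: int}"
    and l: "l \<tau> holomorphic_on UNIV" "\<And>z. l \<tau> z = 0 \<longleftrightarrow> z \<in> period_lattice \<tau>"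
      "\<And>z. z \<in> period_lattice \<tau> \<Longrightarrow> deriv (l \<tau>) z \<noteq> 0"
    and h: "\<And>a b. (\<lambda>t. h (a + t *s b)) holomorphic_on UNIV"
    and s: "\<And>v. (\<tau>, v) \<in> off_divisors U \<Longrightarrow> s (\<tau>, v) = h v * theta3_frame l (\<tau>, v) powi \<epsilon>"
    and inv: "\<And>v n m. s (\<tau>, \<chi> i. v $ i + of_int (n $ i) - \<tau> * of_int (m $ i)) = s (\<tau>, v)"
    and v: "(\<tau>, v) \<in> off_divisors U"
  shows "s (\<tau>, v) = h 0 * theta3_frame upsilon (\<tau>, v) powi \<epsilon>"
proof -
  have Im: "Im \<tau> > 0" using \<tau> by (auto simp: upper_half_plane_def)
  obtain g where g: "g holomorphic_on UNIV" "\<And>z. g z \<noteq> 0" "\<And>z. l \<tau> z = g z * upsilon \<tau> z"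
    by (rule entire_quotient_simple_zeros[OF l(1) upsilon_entire[OF Im]])
       (use l upsilon_simple_zero[OF Im] upsilon_eq_0_iff[OF Im] in auto)
  have frame: "theta3_frame l (\<tau>, v) = cube g v * theta3_frame upsilon (\<tau>, v)" for v
    by (rule theta3_frame_change) (use g Im upsilon_field_differentiable upsilon_zero in auto)
  define H where "H v = h v * cube g v powi \<epsilon>" for v
  have sH: "s (\<tau>, v) = H v * theta3_frame upsilon (\<tau>, v) powi \<epsilon>" if "(\<tau>, v) \<in> off_divisors U" for v
    using s[OF that] by (simp add: frame H_def power_int_mult_distrib)
  have nz: "theta3_frame upsilon (\<tau>, v) powi \<epsilon> \<noteq> 0" if "(\<tau>, v) \<in> off_divisors U" for v
    using theta3_frame_upsilon_nonzero[OF that \<tau>(2)] by simp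
  have "H v = H 0"
  proof (rule lattice_invariant_constant[OF Im \<tau>(1) _ _ v])
    fix a b :: "complex ^ 3"
    have "(\<lambda>t. cube g (a + t *s b) powi \<epsilon>) holomorphic_on UNIV"
      using \<epsilon> cube_holomorphic_on_lines[OF g(1,2), of a b] cube_nonzero[OF g(2)]
      by (auto simp: power_int_minus intro!: holomorphic_intros)
    then show "(\<lambda>t. H (a + t *s b)) holomorphic_on UNIV"
      unfolding H_def by (intro holomorphic_on_mult h)
  next
    fix w and n m :: "int ^ 3" assume w: "(\<tau>, w) \<in> off_divisors U"
    let ?w = "\<chi> i. w $ i + of_int (n $ i) - \<tau> * of_int (m $ i)"
    have w': "(\<tau>, ?w) \<in> off_divisors U" using w by (simp only: off_divisors_shift_iff)
    have "H ?w * theta3_frame upsilon (\<tau>, w) powi \<epsilon> = H w * theta3_frame upsilon (\<tau>, w) powi \<epsilon>"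
      using sH[OF w'] sH[OF w] inv[of w n m] by (simp only: theta3_frame_upsilon_shift[OF Im])
    then show "H ?w = H w" using mult_right_cancel[OF nz[OF w]] by blast
  qed
  also have "H 0 = h 0" using g(2) by (simp add: H_def cube_def)
  finally show ?thesis using sH[OF v] by simp
qed

section \<open>Frames over the base\<close>

text \<open>The local ambient extensions are differentiable with complex linear derivative, and the complex
lines lie inside a fibre of \<open>U \<times> \<complex>\<^sup>n\<close>, where the extensions
agree with \<open>f\<close>.\<close>

lemma holomorphic_over_line:
  fixes a b :: "complex ^ 'n"
  assumes "holomorphic_over U f" "\<tau> \<in> U"
  shows "(\<lambda>t. f (\<tau>, a + t *s b)) holomorphic_on UNIV"
proof -
  let ?j = "\<lambda>t. (\<tau>, a + t *s b)"
  have "bounded_linear (\<lambda>t. t *s b)"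
    unfolding linear_conv_bounded_linear[symmetric]
    by (rule linearI) (simp_all add: vec_eq_iff ring_distribs)
  then have j: "(?j has_derivative (\<lambda>t. (0, t *s b))) (at t)" for t
    by (auto intro!: derivative_eq_intros bounded_linear_imp_has_derivative)
  have "(\<lambda>t. f (?j t)) field_differentiable at t" for t
  proof -
    obtain N F where NF: "open N" "?j t \<in> N" "\<forall>q\<in>N. complex_differentiable_at F q"
      "\<forall>q\<in>N \<inter> (U \<times> UNIV). F q = f q"
      using assms unfolding holomorphic_over_def by blast
    obtain D where D: "(F has_derivative D) (at (?j t))" "\<And>c \<tau> v. D (c * \<tau>, c *s v) = c * D (\<tau>, v)"
      using NF unfolding complex_differentiable_at_def by blast
    have "((\<lambda>t. F (?j t)) has_derivative (\<lambda>t. D (0, t *s b))) (at t)"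
      using has_derivative_compose[OF j D(1)] by simp
    moreover have "(\<lambda>t. D (0, t *s b)) = (\<lambda>t. D (0, b) * t)"
      using D(2)[of _ 0 b] by (simp add: fun_eq_iff mult.commute)
    ultimately have "((\<lambda>t. F (?j t)) has_field_derivative D (0, b)) (at t)"
      by (simp add: has_field_derivative_def)
    moreover have "open (?j -` N)"
      using NF(1) j by (intro continuous_open_vimage) (auto intro: has_derivative_continuous)
    ultimately have "((\<lambda>t. f (?j t)) has_field_derivative D (0, b)) (at t)"
      by (rule has_field_derivative_transform_within_open) (use NF assms in auto)
    then show ?thesis by (auto simp: field_differentiable_def)
  qed
  then show ?thesis by (simp add: holomorphic_on_def field_differentiable_at_within)
qed

lemma frame_O_entire:
  assumes "frame_O U l" "\<tau> \<in> U" shows "l \<tau> holomorphic_on UNIV"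
proof -
  have "(\<lambda>t. (\<lambda>(\<tau>, v :: complex ^ 1). l \<tau> (v $ 1)) (\<tau>, 0 + t *s 1)) holomorphic_on UNIV"
    using assms by (intro holomorphic_over_line) (auto simp: frame_O_def)
  then show ?thesis by simp
qed

lemma theta3_coordinate_eq:
  assumes U: "U \<subseteq> upper_half_plane" and \<epsilon>: "\<epsilon> \<in> {1, -1 :: int}"
    and s: "theta3_section \<epsilon> U s" and l: "frame_O U l" and h: "theta3_coordinate \<epsilon> U l s h"
    and v: "(\<tau>, v) \<in> off_divisors U"
  shows "s (\<tau>, v) = h (\<tau>, 0) * theta3_frame upsilon (\<tau>, v) powi \<epsilon>"
proof -
  have \<tau>: "\<tau> \<in> U" using v by (simp add: off_divisors_iff)
  show ?thesis
  proof (rule theta3_rigidity[where l = l and h = "\<lambda>v. h (\<tau>, v)" and U = U])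
    show "l \<tau> holomorphic_on UNIV" by (rule frame_O_entire[OF l \<tau>])
    show "l \<tau> z = 0 \<longleftrightarrow> z \<in> period_lattice \<tau>" for z using l \<tau> by (auto simp: frame_O_def)
    show "deriv (l \<tau>) z \<noteq> 0" if "z \<in> period_lattice \<tau>" for z using l \<tau> that by (auto simp: frame_O_def)
    show "(\<lambda>t. h (\<tau>, a + t *s b)) holomorphic_on UNIV" for a b
      using h \<tau> by (intro holomorphic_over_line) (auto simp: theta3_coordinate_def)
    show "s (\<tau>, v) = h (\<tau>, v) * theta3_frame l (\<tau>, v) powi \<epsilon>" if "(\<tau>, v) \<in> off_divisors U" for v
      using h that by (simp add: theta3_coordinate_def)
    show "s (\<tau>, \<chi> i. v $ i + of_int (n $ i) - \<tau> * of_int (m $ i)) = s (\<tau>, v)" for v n m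
      using s \<tau> by (simp add: theta3_section_def)
  qed fact+
qed

lemma frame_O_upsilon:
  assumes "U \<subseteq> upper_half_plane" shows "frame_O U upsilon"
proof -
  let ?f = "\<lambda>(\<tau>, z). upsilon \<tau> z" and ?F = "\<lambda>(\<tau>, v :: complex ^ 1). upsilon \<tau> (v $ 1)"
  have cont: "continuous_on half_plane_times_plane ?f"
  proof -
    have "?f = (\<lambda>p. (1 - exp (2 * of_real pi * \<i> * snd p)) * sigma_product p)"
      by (auto simp: upsilon_eq)
    moreover have "continuous_on half_plane_times_plane (\<lambda>p. 1 - exp (2 * of_real pi * \<i> * snd p))"
      by (intro continuous_intros)
    ultimately show ?thesis using continuous_on_mult[OF _ continuous_sigma_product] by simp
  qed
  have diff: "complex_differentiable_at ?F (\<tau>, v)" if "\<tau> \<in> upper_half_plane" for \<tau> v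
  proof -
    have "\<exists>A B. (?f has_derivative (\<lambda>(s, t). A * s + B * t)) (at (\<tau>, v $ 1))"
      by (rule separately_holomorphic_imp_differentiable[OF open_Times[OF open_upper_half_plane open_UNIV] cont])
        (use that upsilon_field_differentiable in \<open>auto simp: upper_half_plane_def\<close>)
    then obtain A B where "(?f has_derivative (\<lambda>(s, t). A * s + B * t)) (at (\<tau>, v $ 1))" by blast
    then have f: "(?f has_derivative (\<lambda>(s, t). A * s + B * t)) (at ((\<lambda>(\<tau>, v). (\<tau>, v $ 1)) (\<tau>, v)))"
      by simp
    have "bounded_linear (\<lambda>(\<tau>, v :: complex ^ 1). (\<tau> :: complex, v $ 1))"
      unfolding case_prod_unfold by (intro bounded_linear_Pair bounded_linear_fst bounded_linear_compose[OF bounded_linear_vec_nth bounded_linear_snd])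
    then have "((\<lambda>(\<tau>, v :: complex ^ 1). (\<tau>, v $ 1)) has_derivative (\<lambda>(\<tau>, v). (\<tau>, v $ 1))) (at (\<tau>, v))"
      by (rule bounded_linear_imp_has_derivative)
    from has_derivative_compose[OF this f]
    have "(?F has_derivative (\<lambda>(s, w). A * s + B * w $ 1)) (at (\<tau>, v))"
      by (simp add: case_prod_unfold)
    then show ?thesis
      unfolding complex_differentiable_at_def by (intro exI conjI) (auto simp: algebra_simps)
  qed
  have "holomorphic_over U ?F"
    unfolding holomorphic_over_def
  proof
    fix p :: "complex \<times> (complex ^ 1)" assume "p \<in> U \<times> UNIV"
    then show "\<exists>N F. open N \<and> p \<in> N \<and> (\<forall>q\<in>N. complex_differentiable_at F q) \<and> (\<forall>q\<in>N \<inter> U \<times> UNIV. F q = ?F q)"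
      using assms diff
      by (intro exI[of _ "upper_half_plane \<times> UNIV"] exI[of _ ?F])
        (auto intro: open_Times open_upper_half_plane)
  qed
  then show ?thesis
    using assms upsilon_eq_0_iff upsilon_simple_zero
    by (auto simp: frame_O_def upper_half_plane_def subset_iff)
qed

section \<open>Power series in three variables\<close>

lemma power_series_coeffs_zero:
  fixes a :: "nat \<Rightarrow> complex"
  assumes "\<rho> > 0" and sums: "\<And>t. 0 < t \<Longrightarrow> t < \<rho> \<Longrightarrow> (\<lambda>n. a n * of_real t ^ n) sums 0"
  shows "a n = 0"
proof -
  define f where "f w = suminf (\<lambda>n. a n * w ^ n)" for w
  define s where "s = \<rho> / 2"
  have s: "0 < s" "s < \<rho>" using assms(1) by (auto simp: s_def)
  have f: "(\<lambda>n. a n * (w - 0) ^ n) sums f w" if "w \<in> ball 0 s" for w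
    using powser_inside[OF sums_summable[OF sums[OF s]], of w] that s
    by (simp add: f_def summable_sums)
  then have hol: "f holomorphic_on ball 0 s" by (rule power_series_holomorphic)
  have zero: "f w = 0" if "w \<in> ball 0 s" for w
  proof (rule analytic_continuation[OF hol, of "of_real ` {0<..<s}" 0])
    show "0 islimpt complex_of_real ` {0<..<s}"
      unfolding islimpt_approachable
    proof (intro allI impI)
      fix e :: real assume "e > 0"
      then show "\<exists>x'\<in>complex_of_real ` {0<..<s}. x' \<noteq> 0 \<and> dist x' 0 < e"
        using s by (intro bexI[of _ "of_real (min e s / 2)"] imageI) (auto simp: min_def)
    qed
    fix z assume "z \<in> complex_of_real ` {0<..<s}"
    then obtain t where t: "z = of_real t" "0 < t" "t < s" by auto
    have "(\<lambda>n. a n * z ^ n) sums 0" using sums[of t] t s by simp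
    then show "f z = 0" unfolding f_def by (rule sums_unique[symmetric])
  qed (use that s in auto)
  show ?thesis
  proof (cases "n = 0")
    case True
    have "f 0 = a 0" using f[of 0] s powser_sums_zero sums_unique2 by fastforce
    then show ?thesis using zero[of 0] s True by simp
  next
    case False
    show ?thesis
    proof (rule ccontr)
      assume "a n \<noteq> 0"
      obtain r where r: "0 < r" "\<And>z. z \<in> cball 0 r - {0} \<Longrightarrow> f z \<noteq> 0"
        by (rule powser_0_nonzero[of s 0 a f n]) (use f s zero False \<open>a n \<noteq> 0\<close> in auto)
      have "f (of_real (min r s / 2)) \<noteq> 0" using r(1) s by (intro r(2)) (auto simp: min_def)
      moreover have "f (of_real (min r s / 2)) = 0" using r(1) s by (intro zero) (auto simp: min_def)
      ultimately show False by simp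
    qed
  qed
qed

text \<open>Separates one variable from a multiple power series: summing over the remaining indices first
leaves a power series in \<open>t\<close>, whose coefficients are the partial sums.\<close>

lemma power_series_family_zero:
  fixes e :: "nat \<Rightarrow> 'a \<Rightarrow> complex"
  assumes "\<rho> > 0"
    and sum: "\<And>t. 0 < t \<Longrightarrow> t < \<rho> \<Longrightarrow> ((\<lambda>(i, \<alpha>). of_real t ^ i * e i \<alpha>) has_sum 0) UNIV"
  shows "(e i has_sum 0) UNIV"
proof -
  have smm: "(e i) summable_on UNIV" for i
  proof -
    define t where "t = \<rho> / 2"
    have t: "0 < t" "t < \<rho>" using assms(1) by (auto simp: t_def)
    have "(\<lambda>(i, \<alpha>). of_real t ^ i * e i \<alpha>) summable_on Sigma UNIV (\<lambda>_. UNIV)"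
      using sum[OF t] by (auto simp: summable_on_def)
    then have "(\<lambda>\<alpha>. of_real t ^ i * e i \<alpha>) summable_on UNIV" by (rule summable_on_SigmaD1) simp
    then show ?thesis using t by (subst (asm) summable_on_cmult_right') auto
  qed
  have "infsum (e i) UNIV = 0" for i
  proof (rule power_series_coeffs_zero[OF assms(1)])
    fix t assume t: "0 < t" "t < \<rho>"
    have "((\<lambda>i. of_real t ^ i * infsum (e i) UNIV) has_sum 0) UNIV"
    proof (rule has_sum_SigmaD)
      show "((\<lambda>(i, \<alpha>). of_real t ^ i * e i \<alpha>) has_sum 0) (Sigma UNIV (\<lambda>_. UNIV))"
        using sum[OF t] by simp
      show "((\<lambda>\<alpha>. case (i, \<alpha>) of (i, \<alpha>) \<Rightarrow> of_real t ^ i * e i \<alpha>) has_sum of_real t ^ i * infsum (e i) UNIV) UNIV" for i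
        using has_sum_cmult_right[OF has_sum_infsum[OF smm[of i]]] by simp
    qed
    then show "(\<lambda>i. infsum (e i) UNIV * of_real t ^ i) sums 0"
      by (auto dest: has_sum_imp_sums simp: mult.commute)
  qed
  then show ?thesis using has_sum_infsum[OF smm[of i]] by simp
qed

definition monomial3 :: "complex ^ 3 \<Rightarrow> nat \<times> nat \<times> nat \<Rightarrow> complex" where
  "monomial3 v = (\<lambda>(i, j, k). (v$1) ^ i * (v$2) ^ j * (v$3) ^ k)"

text \<open>Small positive real arguments suffice. They avoid all the divisors, since sums of positive reals
below \<open>1\<close> are never lattice points, so the coefficients can be compared without
regard to the excluded set.\<close>

lemma triple_power_series_zero:
  fixes d :: "nat \<times> nat \<times> nat \<Rightarrow> complex"
  assumes "\<rho> > 0"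
    and sum: "\<And>x y z. 0 < x \<Longrightarrow> x < \<rho> \<Longrightarrow> 0 < y \<Longrightarrow> y < \<rho> \<Longrightarrow> 0 < z \<Longrightarrow> z < \<rho> \<Longrightarrow>
      ((\<lambda>\<alpha>. d \<alpha> * monomial3 (vector [of_real x, of_real y, of_real z]) \<alpha>) has_sum 0) UNIV"
  shows "d = (\<lambda>_. 0)"
proof -
  have *: "((\<lambda>(i, j, k). of_real x ^ i * (of_real y ^ j * (of_real z ^ k * d (i, j, k)))) has_sum 0) UNIV"
    if "0 < x" "x < \<rho>" "0 < y" "y < \<rho>" "0 < z" "z < \<rho>" for x y z
    using sum[OF that] by (simp add: monomial3_def case_prod_unfold mult_ac)
  have 1: "((\<lambda>(j, k). of_real y ^ j * (of_real z ^ k * d (i, j, k))) has_sum 0) UNIV"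
    if "0 < y" "y < \<rho>" "0 < z" "z < \<rho>" for y z i
    by (rule power_series_family_zero[OF assms(1)])
      (use *[OF _ _ that] in \<open>simp add: case_prod_unfold\<close>)
  have 2: "((\<lambda>k. of_real z ^ k * d (i, j, k)) has_sum 0) UNIV" if "0 < z" "z < \<rho>" for z i j
    by (rule power_series_family_zero[OF assms(1) 1]) (use that in auto)
  have "d (i, j, k) = 0" for i j k
  proof (rule power_series_coeffs_zero[OF assms(1)])
    fix t assume "0 < t" "t < \<rho>"
    then show "(\<lambda>k. d (i, j, k) * of_real t ^ k) sums 0"
      using has_sum_imp_sums[OF 2[of t i j]] by (simp add: mult.commute)
  qed
  then show ?thesis by (auto simp: fun_eq_iff)
qed

definition power_series_near_0 :: "(complex ^ 3 \<Rightarrow> complex) \<Rightarrow> bool" where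
  "power_series_near_0 f \<longleftrightarrow>
     (\<exists>c. \<exists>r>0. \<forall>v. norm v < r \<longrightarrow> ((\<lambda>\<alpha>. c \<alpha> * monomial3 v \<alpha>) has_sum f v) UNIV)"

lemma has_sum_complex_product:
  fixes F :: "'a \<Rightarrow> complex" and G :: "'b \<Rightarrow> complex"
  assumes F: "(F has_sum x) UNIV" and G: "(G has_sum y) UNIV"
  shows "((\<lambda>(\<alpha>, \<beta>). F \<alpha> * G \<beta>) has_sum x * y) UNIV"
proof -
  have absF: "(\<lambda>\<alpha>. norm (F \<alpha>)) summable_on UNIV"
    and absG: "(\<lambda>\<beta>. norm (G \<beta>)) summable_on UNIV"
    using F G by (auto simp flip: summable_on_iff_abs_summable_on_complex simp: summable_on_def)
  have "(\<lambda>p. norm (case p of (\<alpha>, \<beta>) \<Rightarrow> F \<alpha> * G \<beta>)) summable_on Sigma UNIV (\<lambda>_. UNIV)"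
    unfolding Infinite_Sum.abs_summable_on_Sigma_iff
  proof (intro conjI ballI)
    show "(\<lambda>\<beta>. norm (case (\<alpha>, \<beta>) of (\<alpha>, \<beta>) \<Rightarrow> F \<alpha> * G \<beta>)) summable_on UNIV" for \<alpha>
      using summable_on_cmult_right[OF absG, of "norm (F \<alpha>)"] by (simp add: norm_mult)
    have "(\<lambda>\<alpha>. norm (F \<alpha>) * infsum (\<lambda>\<beta>. norm (G \<beta>)) UNIV) summable_on UNIV"
      by (rule summable_on_cmult_left[OF absF])
    then show "(\<lambda>\<alpha>. norm (infsum (\<lambda>\<beta>. norm (case (\<alpha>, \<beta>) of (\<alpha>, \<beta>) \<Rightarrow> F \<alpha> * G \<beta>)) UNIV)) summable_on UNIV"
      by (subst summable_on_iff_abs_summable_on_real[symmetric])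
        (simp add: norm_mult infsum_cmult_right')
  qed
  then have "(\<lambda>(\<alpha>, \<beta>). F \<alpha> * G \<beta>) summable_on Sigma UNIV (\<lambda>_. UNIV)" by (rule abs_summable_summable)
  then have "((\<lambda>(\<alpha>, \<beta>). F \<alpha> * G \<beta>) has_sum x * y) (Sigma UNIV (\<lambda>_. UNIV))"
    by (intro has_sum_SigmaI[where g = "\<lambda>\<alpha>. F \<alpha> * y"])
      (auto intro: has_sum_cmult_right[OF G] has_sum_cmult_left[OF F])
  then show ?thesis by simp
qed

lemma finite_pairs_with_sum: "finite {(\<alpha>, \<beta>). \<alpha> + \<beta> = (\<gamma> :: nat \<times> nat \<times> nat)}"
proof -
  obtain a b c where \<gamma>: "\<gamma> = (a, b, c)" by (cases \<gamma>)
  have "{(\<alpha>, \<beta>). \<alpha> + \<beta> = \<gamma>} \<subseteq> ({..a} \<times> {..b} \<times> {..c}) \<times> ({..a} \<times> {..b} \<times> {..c})"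
    by (auto simp: \<gamma>)
  then show ?thesis by (rule finite_subset) auto
qed

text \<open>The Cauchy product: absolute convergence of the double family allows regrouping by the sum of
the exponents.\<close>

lemma power_series_near_0_mult:
  assumes "power_series_near_0 f" "power_series_near_0 g"
  shows "power_series_near_0 (\<lambda>v. f v * g v)"
proof -
  obtain c r where c: "r > 0" "\<And>v. norm v < r \<Longrightarrow> ((\<lambda>\<alpha>. c \<alpha> * monomial3 v \<alpha>) has_sum f v) UNIV"
    using assms(1) unfolding power_series_near_0_def by blast
  obtain d r' where d: "r' > 0" "\<And>v. norm v < r' \<Longrightarrow> ((\<lambda>\<alpha>. d \<alpha> * monomial3 v \<alpha>) has_sum g v) UNIV"
    using assms(2) unfolding power_series_near_0_def by blast
  define e where "e \<gamma> = (\<Sum>(\<alpha>, \<beta>)\<in>{(\<alpha>, \<beta>). \<alpha> + \<beta> = \<gamma>}. c \<alpha> * d \<beta>)" for \<gamma>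
  have "((\<lambda>\<gamma>. e \<gamma> * monomial3 v \<gamma>) has_sum f v * g v) UNIV" if "norm v < min r r'" for v
  proof -
    have "((\<lambda>(\<alpha>, \<beta>). (c \<alpha> * monomial3 v \<alpha>) * (d \<beta> * monomial3 v \<beta>)) has_sum f v * g v) UNIV"
      using that by (intro has_sum_complex_product c d) auto
    also have "?this \<longleftrightarrow> ((\<lambda>(\<gamma>, \<alpha>, \<beta>). c \<alpha> * d \<beta> * monomial3 v \<gamma>) has_sum f v * g v)
        (Sigma UNIV (\<lambda>\<gamma>. {(\<alpha>, \<beta>). \<alpha> + \<beta> = \<gamma>}))"
      by (rule has_sum_reindex_bij_witness[where j = "\<lambda>(\<alpha>, \<beta>). (\<alpha> + \<beta>, \<alpha>, \<beta>)" and i = snd])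
        (auto simp: monomial3_def power_add)
    finally show ?thesis
    proof (rule has_sum_SigmaD)
      show "((\<lambda>y. case (\<gamma>, y) of (\<gamma>, \<alpha>, \<beta>) \<Rightarrow> c \<alpha> * d \<beta> * monomial3 v \<gamma>) has_sum e \<gamma> * monomial3 v \<gamma>)
          {(\<alpha>, \<beta>). \<alpha> + \<beta> = \<gamma>}" for \<gamma>
        by (rule has_sum_finiteI[OF finite_pairs_with_sum])
          (simp add: e_def sum_distrib_right case_prod_unfold)
    qed
  qed
  then show ?thesis unfolding power_series_near_0_def
    using c(1) d(1) by (intro exI[of _ e] exI[of _ "min r r'"]) auto
qed

text \<open>The binomial theorem twice, with the multinomial coefficient left as a product of binomial
coefficients.\<close>

lemma trinomial:
  fixes x y z :: "'a :: comm_semiring_1"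
  shows "(\<Sum>(i, j, k)\<in>{(i, j, k). i + j + k = n}.
      of_nat ((n choose i) * ((n - i) choose j)) * (x ^ i * y ^ j * z ^ k)) = (x + y + z) ^ n"
    and "finite {(i, j, k). i + j + k = (n::nat)}"
proof -
  have "(x + y + z) ^ n = (\<Sum>i\<le>n. of_nat (n choose i) * x ^ i * (y + z) ^ (n - i))"
    unfolding add.assoc by (rule binomial_ring)
  also have "\<dots> = (\<Sum>i\<le>n. \<Sum>j\<le>n - i. of_nat (n choose i) * x ^ i * (of_nat ((n - i) choose j) * y ^ j * z ^ (n - i - j)))"
    by (simp only: binomial_ring sum_distrib_left)
  also have "\<dots> = (\<Sum>(i, j)\<in>Sigma {..n} (\<lambda>i. {..n - i}).
      of_nat (n choose i) * x ^ i * (of_nat ((n - i) choose j) * y ^ j * z ^ (n - i - j)))"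
    by (rule sum.Sigma) auto
  also have "\<dots> = (\<Sum>(i, j, k)\<in>{(i, j, k). i + j + k = n}.
      of_nat ((n choose i) * ((n - i) choose j)) * (x ^ i * y ^ j * z ^ k))"
    by (rule sum.reindex_bij_witness[where j = "\<lambda>(i, j). (i, j, n - i - j)" and i = "\<lambda>(i, j, k). (i, j)"])
      (auto simp: mult_ac)
  finally show "(\<Sum>(i, j, k)\<in>{(i, j, k). i + j + k = n}.
      of_nat ((n choose i) * ((n - i) choose j)) * (x ^ i * y ^ j * z ^ k)) = (x + y + z) ^ n" ..
  have "{(i, j, k). i + j + k = n} \<subseteq> {..n} \<times> {..n} \<times> {..n}" by auto
  then show "finite {(i, j, k). i + j + k = n}" by (rule finite_subset) auto
qed

text \<open>Each power of the linear form is expanded by the trinomial formula. The triple series converges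
absolutely because the sums of absolute values are the same expansion at the absolute values of
the arguments. With coefficients \<open>0\<close> and \<open>1\<close> this covers all the
arguments that occur in a theta frame.\<close>

lemma power_series_near_0_linear_form:
  fixes a b c :: complex
  assumes g: "g holomorphic_on ball 0 R" and "R > 0"
    and ab: "norm a \<le> 1" "norm b \<le> 1" "norm c \<le> 1"
  shows "power_series_near_0 (\<lambda>v. g (a * v$1 + b * v$2 + c * v$3))"
proof -
  define u where "u n = (deriv ^^ n) g 0 / fact n" for n
  have u: "(\<lambda>n. u n * w ^ n) sums g w" if "norm w < R" for w
    using holomorphic_power_series[OF g, of w] that by (simp add: u_def)
  have absu: "summable (\<lambda>n. norm (u n) * t ^ n)" if "0 \<le> t" "t < R" for t
  proof -
    define t' where "t' = (t + R) / 2"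
    have t': "t < t'" "t' < R" "0 < t'" using that by (auto simp: t'_def)
    have "summable (\<lambda>n. norm (u n * of_real t ^ n))"
      by (rule powser_insidea[OF sums_summable[OF u[of "of_real t'"]]]) (use t' that in auto)
    then show ?thesis using that by (simp add: norm_mult norm_power)
  qed
  define T where "T n = {(i, j, k). i + j + k = (n::nat)}" for n
  define d where "d = (\<lambda>(i, j, k). u (i + j + k) * of_nat (((i + j + k) choose i) * ((i + j + k - i) choose j))
      * (a ^ i * b ^ j * c ^ k))"
  have "((\<lambda>\<alpha>. d \<alpha> * monomial3 v \<alpha>) has_sum g (a * v$1 + b * v$2 + c * v$3)) UNIV"
    if "norm v < R / 3" for v
  proof -
    define x y z where xyz: "x = a * v$1" "y = b * v$2" "z = c * v$3"
    have "norm x \<le> norm v" "norm y \<le> norm v" "norm z \<le> norm v"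
      unfolding xyz norm_mult using ab component_le_norm_cart
      by (meson Finite_Cartesian_Product.norm_nth_le mult_le_one mult_left_le_one_le norm_ge_zero order_trans)+
    then have t: "norm x + norm y + norm z < R" using that by simp
    have w: "norm (x + y + z) < R"
      using norm_triangle_ineq[of "x + y" z] norm_triangle_ineq[of x y] t by simp
    let ?f = "\<lambda>(n, i, j, k). u n * (of_nat ((n choose i) * ((n - i) choose j)) * (x ^ i * y ^ j * z ^ k))"
    have in1: "((\<lambda>\<alpha>. ?f (n, \<alpha>)) has_sum u n * (x + y + z) ^ n) (T n)" for n
      unfolding T_def
      by (rule has_sum_finiteI[OF trinomial(2)])
        (simp add: trinomial(1)[symmetric] sum_distrib_left case_prod_unfold)
    have in2: "((\<lambda>\<alpha>. norm (?f (n, \<alpha>))) has_sum norm (u n) * (norm x + norm y + norm z) ^ n) (T n)" for n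
      unfolding T_def
      by (rule has_sum_finiteI[OF trinomial(2)])
        (simp add: trinomial(1)[symmetric] sum_distrib_left case_prod_unfold norm_mult norm_power)
    have "(\<lambda>n. norm (u n) * (norm x + norm y + norm z) ^ n) summable_on UNIV"
      using absu[of "norm x + norm y + norm z"] t
      by (intro norm_summable_imp_summable_on) (auto simp: abs_mult)
    then have "(\<lambda>p. norm (?f p)) summable_on Sigma UNIV T"
      by (rule summable_on_SigmaI[OF in2]) auto
    then have "?f summable_on Sigma UNIV T" by (rule abs_summable_summable)
    moreover have "((\<lambda>n. u n * (x + y + z) ^ n) has_sum g (x + y + z)) UNIV"
    proof (rule norm_summable_imp_has_sum[OF _ u[OF w]])
      show "summable (\<lambda>n. norm (u n * (x + y + z) ^ n))"
        using absu[of "norm (x + y + z)"] w by (simp add: norm_mult norm_power)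
    qed
    ultimately have "(?f has_sum g (x + y + z)) (Sigma UNIV T)"
      by (intro has_sum_SigmaI[OF in1]) auto
    also have "?this \<longleftrightarrow> ((\<lambda>\<alpha>. d \<alpha> * monomial3 v \<alpha>) has_sum g (x + y + z)) UNIV"
      by (rule has_sum_reindex_bij_witness[where j = snd and i = "\<lambda>(i, j, k). (i + j + k, i, j, k)"])
        (auto simp: T_def d_def monomial3_def xyz power_mult_distrib mult_ac)
    finally show ?thesis by (simp add: xyz)
  qed
  then show ?thesis unfolding power_series_near_0_def
    using \<open>R > 0\<close> by (intro exI[of _ d] exI[of _ "R / 3"]) auto
qed

section \<open>The cubical structure\<close>

text \<open>The theta frame of \<open>\<upsilon>\<close> as a section; it is the cubical structure and the
equivariant refinement.\<close>

definition euler_section :: "int \<Rightarrow> complex set \<Rightarrow> complex \<times> (complex ^ 3) \<Rightarrow> complex" where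
  "euler_section \<epsilon> U p = (if p \<in> off_divisors U then theta3_frame upsilon p powi \<epsilon> else 0)"

lemma holomorphic_over_const: "holomorphic_over U (\<lambda>_. c)"
proof -
  have "complex_differentiable_at (\<lambda>_ :: complex \<times> (complex ^ 'a). c) q" for q
    unfolding complex_differentiable_at_def by (intro exI[of _ "\<lambda>_. 0"]) simp
  then show ?thesis unfolding holomorphic_over_def
    by (intro ballI exI[of _ UNIV] exI[of _ "\<lambda>_. c"]) simp
qed

lemma theta3_coordinate_euler_section:
  "theta3_coordinate \<epsilon> U upsilon (euler_section \<epsilon> U) (\<lambda>_. 1)"
  by (simp add: theta3_coordinate_def holomorphic_over_const euler_section_def)

lemma theta3_section_euler_section:
  assumes "U \<subseteq> upper_half_plane" shows "theta3_section \<epsilon> U (euler_section \<epsilon> U)"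
  unfolding theta3_section_def
proof (intro conjI allI ballI impI)
  show "\<exists>l h. frame_O U l \<and> theta3_coordinate \<epsilon> U l (euler_section \<epsilon> U) h"
    using frame_O_upsilon[OF assms] theta3_coordinate_euler_section by blast
  fix \<tau> v and n m :: "int ^ 3" assume "\<tau> \<in> U"
  then have "Im \<tau> > 0" using assms by (auto simp: upper_half_plane_def)
  then show "euler_section \<epsilon> U (\<tau>, \<chi> i. v $ i + of_int (n $ i) - \<tau> * of_int (m $ i)) = euler_section \<epsilon> U (\<tau>, v)"
    by (simp only: euler_section_def off_divisors_shift_iff theta3_frame_upsilon_shift)
qed (simp add: euler_section_def)

lemma euler_section_permute:
  assumes "bij (\<pi> :: 3 \<Rightarrow> 3)"
  shows "euler_section \<epsilon> U (\<tau>, \<chi> i. v $ \<pi> i) = euler_section \<epsilon> U (\<tau>, v)"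
proof -
  have inj: "\<pi> 1 \<noteq> \<pi> 2" "\<pi> 1 \<noteq> \<pi> 3" "\<pi> 2 \<noteq> \<pi> 3"
    using bij_is_inj[OF assms] by (simp_all add: inj_eq)
  consider "\<pi> 1 = 1" "\<pi> 2 = 2" "\<pi> 3 = 3" | "\<pi> 1 = 1" "\<pi> 2 = 3" "\<pi> 3 = 2"
    | "\<pi> 1 = 2" "\<pi> 2 = 1" "\<pi> 3 = 3" | "\<pi> 1 = 2" "\<pi> 2 = 3" "\<pi> 3 = 1"
    | "\<pi> 1 = 3" "\<pi> 2 = 1" "\<pi> 3 = 2" | "\<pi> 1 = 3" "\<pi> 2 = 2" "\<pi> 3 = 1"
    using inj exhaust_3[of "\<pi> 1"] exhaust_3[of "\<pi> 2"] exhaust_3[of "\<pi> 3"] by metis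
  then have "(\<tau>, \<chi> i. v $ \<pi> i) \<in> off_divisors U \<longleftrightarrow> (\<tau>, v) \<in> off_divisors U"
    and "theta3_frame upsilon (\<tau>, \<chi> i. v $ \<pi> i) = theta3_frame upsilon (\<tau>, v)"
    by (cases; simp add: off_divisors_iff theta3_frame_def add_ac mult_ac conj_ac)+
  then show ?thesis by (simp add: euler_section_def)
qed

text \<open>Both sides are ratios of the same values of \<open>\<upsilon>\<close> after cancelling those at
\<open>w + x\<close>, \<open>x + y\<close>, \<open>w + x + z\<close> and \<open>x + y +
z\<close>, which are nonzero off the divisors.\<close>

lemma theta3_frame_upsilon_cocycle:
  assumes "U \<subseteq> upper_half_plane"
    and off: "(\<tau>, vector [w + x, y, z]) \<in> off_divisors U" "(\<tau>, vector [w, x, z]) \<in> off_divisors U"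
      "(\<tau>, vector [w, x + y, z]) \<in> off_divisors U" "(\<tau>, vector [x, y, z]) \<in> off_divisors U"
  shows "theta3_frame upsilon (\<tau>, vector [w + x, y, z]) * theta3_frame upsilon (\<tau>, vector [w, x, z]) =
    theta3_frame upsilon (\<tau>, vector [w, x + y, z]) * theta3_frame upsilon (\<tau>, vector [x, y, z])"
proof -
  have \<tau>: "Im \<tau> > 0" using off(1) assms(1) by (auto simp: off_divisors_iff upper_half_plane_def)
  let ?u = "upsilon \<tau>"
  have nz: "deriv ?u 0 \<noteq> 0" "?u (w + x) \<noteq> 0" "?u (x + y) \<noteq> 0" "?u (w + x + z) \<noteq> 0" "?u (x + y + z) \<noteq> 0"
      "?u (w + x + y) \<noteq> 0" "?u (w + z) \<noteq> 0" "?u (x + z) \<noteq> 0" "?u (y + z) \<noteq> 0"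
    using off \<tau> by (auto simp: off_divisors_iff upsilon_eq_0_iff deriv_upsilon_0 add.assoc)
  have assoc: "w + (x + y) + z = w + x + y + z" "w + (x + y) = w + x + y" by simp_all
  show ?thesis
    unfolding theta3_frame_def case_prod_conv vector_3 assoc times_divide_times_eq
    by (subst frac_eq_eq) (simp_all only: nz mult_ac mult_eq_0_iff simp_thms)
qed

lemma cubical_structure_euler_section:
  assumes U: "U \<subseteq> upper_half_plane" shows "cubical_structure \<epsilon> U (euler_section \<epsilon> U)"
  unfolding cubical_structure_def
proof (intro conjI allI impI)
  show "theta3_section \<epsilon> U (euler_section \<epsilon> U)" by (rule theta3_section_euler_section[OF U])
  show "\<exists>l h. frame_O U l \<and> theta3_coordinate \<epsilon> U l (euler_section \<epsilon> U) h \<and> (\<forall>\<tau>\<in>U. h (\<tau>, 0) = 1)"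
    using frame_O_upsilon[OF U] theta3_coordinate_euler_section by fastforce
  show "euler_section \<epsilon> U (\<tau>, \<chi> i. v $ \<pi> i) = euler_section \<epsilon> U (\<tau>, v)" if "bij \<pi>" for \<pi> :: "3 \<Rightarrow> 3" and \<tau> v
    by (rule euler_section_permute[OF that])
  fix \<tau> w x y z
  assume "{(\<tau>, vector [w + x, y, z]), (\<tau>, vector [w, x, z]),
    (\<tau>, vector [w, x + y, z]), (\<tau>, vector [x, y, z])} \<subseteq> off_divisors U"
  then show "euler_section \<epsilon> U (\<tau>, vector [w + x, y, z]) * euler_section \<epsilon> U (\<tau>, vector [w, x, z]) =
    euler_section \<epsilon> U (\<tau>, vector [w, x + y, z]) * euler_section \<epsilon> U (\<tau>, vector [x, y, z])"
    using theta3_frame_upsilon_cocycle[OF U, of \<tau> w x y z]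
    by (simp add: euler_section_def flip: power_int_mult_distrib)
qed

lemma theta3_section_eqI:
  assumes "theta3_section \<epsilon> U s" "\<And>\<tau> v. (\<tau>, v) \<in> off_divisors U \<Longrightarrow> s (\<tau>, v) = theta3_frame upsilon (\<tau>, v) powi \<epsilon>"
  shows "s = euler_section \<epsilon> U"
proof
  fix p
  have "s p = 0" if "p \<notin> off_divisors U"
    using assms(1) that unfolding theta3_section_def by blast
  then show "s p = euler_section \<epsilon> U p"
    using assms(2) by (cases p) (auto simp: euler_section_def)
qed

text \<open>The analytic part of the theorem of the cube: normalisation at \<open>(e, e, e)\<close> fixes
the constant that rigidity leaves open.\<close>

lemma cubical_structure_iff:
  assumes "U \<subseteq> upper_half_plane" "\<epsilon> \<in> {1, -1}"
  shows "cubical_structure \<epsilon> U s \<longleftrightarrow> s = euler_section \<epsilon> U"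
proof
  assume s: "cubical_structure \<epsilon> U s"
  then obtain l h where lh: "frame_O U l" "theta3_coordinate \<epsilon> U l s h" "\<forall>\<tau>\<in>U. h (\<tau>, 0) = 1"
    unfolding cubical_structure_def by blast
  have sec: "theta3_section \<epsilon> U s" using s by (simp add: cubical_structure_def)
  show "s = euler_section \<epsilon> U"
  proof (rule theta3_section_eqI[OF sec])
    fix \<tau> v assume "(\<tau>, v) \<in> off_divisors U"
    then show "s (\<tau>, v) = theta3_frame upsilon (\<tau>, v) powi \<epsilon>"
      using theta3_coordinate_eq[OF assms sec lh(1,2)] lh(3) by (simp add: off_divisors_iff)
  qed
qed (use cubical_structure_euler_section[OF assms(1)] in simp)

lemma AHS_class_eq:
  assumes "U \<subseteq> upper_half_plane" "\<epsilon> \<in> {1, -1}"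
  shows "AHS_class \<epsilon> U = completion \<epsilon> U (euler_section \<epsilon> U)"
  unfolding AHS_class_def cubical_structure_iff[OF assms] by simp

section \<open>Completion and uniqueness of the refinement\<close>

text \<open>Near the zero section \<open>\<upsilon>\<close> and the coordinate \<open>z\<close> are both
frames of \<open>O(-0)\<close>; their quotient converts between the global frame and the one
used for the completion.\<close>

lemma upsilon_divided_by_coordinate:
  assumes "Im \<tau> > 0"
  obtains g where "g holomorphic_on UNIV" "g 0 \<noteq> 0" "\<And>z. upsilon \<tau> z = g z * z"
proof -
  \<comment> \<open>The last term is zero; it gives the function the shape required by \<open>pole_theorem\<close>.\<close>
  let ?g = "\<lambda>z. if z = 0 then deriv (upsilon \<tau>) 0 else upsilon \<tau> z / z - upsilon \<tau> 0 / (z - 0)"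
  have "?g holomorphic_on UNIV" by (rule pole_theorem[OF upsilon_entire[OF assms]]) auto
  then show ?thesis
    by (rule that) (auto simp: deriv_upsilon_0[OF assms] upsilon_zero)
qed

lemma power_series_near_0_cube:
  assumes g: "g holomorphic_on UNIV" "g 0 \<noteq> 0" and \<epsilon>: "\<epsilon> \<in> {1, -1 :: int}"
  shows "power_series_near_0 (\<lambda>v. cube g v powi \<epsilon>)"
proof -
  have "isCont g 0" using holomorphic_on_imp_continuous_on[OF g(1)] by (simp add: continuous_on_eq_continuous_at)
  then obtain R where R: "R > 0" "\<And>z. z \<in> ball 0 R \<Longrightarrow> g z \<noteq> 0"
    using continuous_at_avoid[of 0 g 0] g(2) by auto
  have product: "power_series_near_0 (\<lambda>v. k (v$1 + v$2 + v$3) * k (v$1) * k (v$2) * k (v$3) *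
      k' (v$1 + v$2) * k' (v$1 + v$3) * k' (v$2 + v$3) * C)"
    if "k holomorphic_on ball 0 R" "k' holomorphic_on ball 0 R" for k k' C
  proof -
    have C: "(\<lambda>_. C) holomorphic_on ball 0 R" by simp
    note lin = power_series_near_0_linear_form[OF _ R(1)]
    show ?thesis
      using lin[OF that(1), of 1 1 1] lin[OF that(1), of 1 0 0] lin[OF that(1), of 0 1 0] lin[OF that(1), of 0 0 1]
        lin[OF that(2), of 1 1 0] lin[OF that(2), of 1 0 1] lin[OF that(2), of 0 1 1] lin[OF C, of 0 0 0]
      by (intro power_series_near_0_mult) simp_all
  qed
  have g1: "g holomorphic_on ball 0 R" using g(1) by (rule holomorphic_on_subset) simp
  have g2: "(\<lambda>z. inverse (g z)) holomorphic_on ball 0 R"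
    using g1 R(2) by (rule holomorphic_on_inverse)
  show ?thesis
  proof (cases "\<epsilon> = 1")
    case True
    then show ?thesis using product[OF g1 g2, of "inverse (g 0)"]
      by (simp add: cube_def divide_inverse mult_ac)
  next
    case False
    then have "\<epsilon> = -1" using \<epsilon> by simp
    then show ?thesis using product[OF g2 g1, of "g 0"]
      by (simp add: cube_def power_int_minus divide_inverse mult_ac)
  qed
qed

lemma euler_section_has_formal_expansion:
  assumes U: "U \<subseteq> upper_half_plane" "\<tau> \<in> U" and \<epsilon>: "\<epsilon> \<in> {1, -1}"
  shows "\<exists>c. has_formal_expansion \<epsilon> U (euler_section \<epsilon> U) \<tau> c"
proof -
  have \<tau>: "Im \<tau> > 0" using U by (auto simp: upper_half_plane_def)
  obtain g where g: "g holomorphic_on UNIV" "g 0 \<noteq> 0" "\<And>z. upsilon \<tau> z = g z * z"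
    using upsilon_divided_by_coordinate[OF \<tau>] by blast
  obtain c r where c: "r > 0" "\<And>v. norm v < r \<Longrightarrow> ((\<lambda>\<alpha>. c \<alpha> * monomial3 v \<alpha>) has_sum cube g v powi \<epsilon>) UNIV"
    using power_series_near_0_cube[OF g(1,2) \<epsilon>] unfolding power_series_near_0_def by blast
  let ?z = "\<lambda>_ z :: complex. z"
  have frame: "theta3_frame upsilon (\<tau>, v) = cube g v * theta3_frame ?z (\<tau>, v)" for v
    by (rule theta3_frame_change) (use g in auto)
  have "euler_section \<epsilon> U (\<tau>, v) / theta3_frame ?z (\<tau>, v) powi \<epsilon> = cube g v powi \<epsilon>"
    if off: "(\<tau>, v) \<in> off_divisors U" for v
  proof -
    have "theta3_frame ?z (\<tau>, v) \<noteq> 0"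
      using theta3_frame_upsilon_nonzero[OF off U(1)] unfolding frame by simp
    then show ?thesis using off by (simp add: euler_section_def frame power_int_mult_distrib)
  qed
  then show ?thesis unfolding has_formal_expansion_def
    using c by (intro exI[of _ c] exI[of _ r]) (auto simp: monomial3_def case_prod_unfold mult.assoc)
qed

lemma small_positive_off_divisors:
  assumes "Im \<tau> > 0" "\<tau> \<in> U" "0 < x" "x < 1/3" "0 < y" "y < 1/3" "0 < z" "z < 1/3"
  shows "(\<tau>, vector [of_real x, of_real y, of_real z]) \<in> off_divisors U"
proof -
  have "of_real t \<notin> period_lattice \<tau>" if t: "0 < t" "t < 1" for t
  proof
    assume "of_real t \<in> period_lattice \<tau>"
    then obtain n m :: int where nm: "of_real t = of_int n - \<tau> * of_int m" by (auto simp: period_lattice_def)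
    then have "Im (of_real t) = Im (of_int n - \<tau> * of_int m)" by (rule arg_cong)
    then have "m = 0" using assms(1) by simp
    then have "t = of_int n" using arg_cong[OF nm, of Re] by simp
    then show False using t by simp
  qed
  from this[of x] this[of y] this[of z] this[of "x + y"] this[of "x + z"] this[of "y + z"] this[of "x + y + z"]
  show ?thesis using assms by (simp add: off_divisors_iff)
qed

lemma has_formal_expansion_unique:
  assumes \<tau>: "Im \<tau> > 0" "\<tau> \<in> U"
    and c: "has_formal_expansion \<epsilon> U s \<tau> c" and d: "has_formal_expansion \<epsilon> U s \<tau> d"
  shows "c = d"
proof -
  let ?S = "\<lambda>v. s (\<tau>, v) / theta3_frame (\<lambda>_ z. z) (\<tau>, v) powi \<epsilon>"
  obtain r where r: "r > 0" "\<And>v. norm v < r \<Longrightarrow> (\<tau>, v) \<in> off_divisors U \<Longrightarrow>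
      ((\<lambda>\<alpha>. c \<alpha> * monomial3 v \<alpha>) has_sum ?S v) UNIV"
    using c unfolding has_formal_expansion_def monomial3_def by (auto simp: case_prod_unfold mult.assoc)
  obtain r' where r': "r' > 0" "\<And>v. norm v < r' \<Longrightarrow> (\<tau>, v) \<in> off_divisors U \<Longrightarrow>
      ((\<lambda>\<alpha>. d \<alpha> * monomial3 v \<alpha>) has_sum ?S v) UNIV"
    using d unfolding has_formal_expansion_def monomial3_def by (auto simp: case_prod_unfold mult.assoc)
  \<comment> \<open>Below \<open>1/3\<close> the sum of the three coordinates stays below \<open>1\<close>; the other bound keeps the vector in both balls.\<close>
  define \<rho> where "\<rho> = min (1/3) (min r r' / 3)"
  have "(\<lambda>\<alpha>. c \<alpha> - d \<alpha>) = (\<lambda>_. 0)"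
  proof (rule triple_power_series_zero)
    show "\<rho> > 0" using r(1) r'(1) by (simp add: \<rho>_def)
    fix x y z assume xyz: "0 < x" "x < \<rho>" "0 < y" "y < \<rho>" "0 < z" "z < \<rho>"
    let ?v = "vector [of_real x, of_real y, of_real z] :: complex ^ 3"
    have "norm ?v \<le> (\<Sum>i\<in>UNIV. norm (?v $ i))"
      unfolding norm_vec_def by (rule L2_set_le_sum) simp
    also have "\<dots> < min r r'" using xyz by (simp add: sum_3 \<rho>_def)
    finally have "norm ?v < min r r'" .
    moreover have "(\<tau>, ?v) \<in> off_divisors U"
      using xyz \<tau> by (intro small_positive_off_divisors) (auto simp: \<rho>_def)
    ultimately have "((\<lambda>\<alpha>. c \<alpha> * monomial3 ?v \<alpha> + (- 1) * (d \<alpha> * monomial3 ?v \<alpha>)) has_sum ?S ?v + (- 1) * ?S ?v) UNIV"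
      by (intro has_sum_add has_sum_cmult_right r r') auto
    then show "((\<lambda>\<alpha>. (c \<alpha> - d \<alpha>) * monomial3 ?v \<alpha>) has_sum 0) UNIV"
      by (simp add: left_diff_distrib)
  qed
  then show ?thesis by (auto simp: fun_eq_iff)
qed

lemma completion_eq:
  assumes "U \<subseteq> upper_half_plane" "\<tau> \<in> U" "has_formal_expansion \<epsilon> U s \<tau> c"
  shows "completion \<epsilon> U s i \<tau> = c i"
proof -
  have "Im \<tau> > 0" using assms by (auto simp: upper_half_plane_def)
  then have "(THE c. has_formal_expansion \<epsilon> U s \<tau> c) = c"
    using assms by (intro the_equality) (auto dest: has_formal_expansion_unique)
  then show ?thesis using assms(2) by (simp add: completion_def)
qed

lemma has_formal_expansion_scale:
  assumes "has_formal_expansion \<epsilon> U s \<tau> c"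
    and s': "\<And>v. (\<tau>, v) \<in> off_divisors U \<Longrightarrow> s' (\<tau>, v) = k * s (\<tau>, v)"
  shows "has_formal_expansion \<epsilon> U s' \<tau> (\<lambda>\<alpha>. k * c \<alpha>)"
proof -
  obtain r where r: "r > 0" "\<forall>v. norm v < r \<and> (\<tau>, v) \<in> off_divisors U \<longrightarrow>
      ((\<lambda>(i, j, l). c (i, j, l) * (v$1) ^ i * (v$2) ^ j * (v$3) ^ l) has_sum
        (s (\<tau>, v) / theta3_frame (\<lambda>_ z. z) (\<tau>, v) powi \<epsilon>)) UNIV"
    using assms(1) unfolding has_formal_expansion_def by blast
  show ?thesis unfolding has_formal_expansion_def
  proof (intro exI[of _ r] conjI allI impI r(1))
    fix v assume v: "norm v < r \<and> (\<tau>, v) \<in> off_divisors U"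
    from has_sum_cmult_right[OF r(2)[rule_format, OF v], of k]
    show "((\<lambda>(i, j, l). k * c (i, j, l) * (v$1) ^ i * (v$2) ^ j * (v$3) ^ l) has_sum
        (s' (\<tau>, v) / theta3_frame (\<lambda>_ z. z) (\<tau>, v) powi \<epsilon>)) UNIV"
      using v s'[of v] by (simp add: case_prod_unfold mult.assoc)
  qed
qed

text \<open>A vanishing expansion would make the section vanish at small generic points, but the theta frame
of \<open>\<upsilon>\<close> has no zeros off the divisors.\<close>

lemma euler_section_expansion_nonzero:
  assumes U: "U \<subseteq> upper_half_plane" "\<tau> \<in> U"
    and c: "has_formal_expansion \<epsilon> U (euler_section \<epsilon> U) \<tau> c"
  shows "\<exists>i. c i \<noteq> 0"
proof (rule ccontr)
  assume "\<nexists>i. c i \<noteq> 0"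
  then have c0: "c = (\<lambda>_. 0)" by auto
  have \<tau>: "Im \<tau> > 0" using U by (auto simp: upper_half_plane_def)
  obtain r where r: "r > 0" "\<And>v. norm v < r \<Longrightarrow> (\<tau>, v) \<in> off_divisors U \<Longrightarrow>
      ((\<lambda>_. 0) has_sum (euler_section \<epsilon> U (\<tau>, v) / theta3_frame (\<lambda>_ z. z) (\<tau>, v) powi \<epsilon>)) (UNIV :: (nat \<times> nat \<times> nat) set)"
    using c unfolding has_formal_expansion_def c0 by (auto simp: case_prod_unfold)
  define t where "t = min (1/4) (r / 4)"
  let ?v = "vector [of_real t, of_real t, of_real t] :: complex ^ 3"
  have t: "0 < t" "t < 1/3" "3 * t < r" using r(1) by (auto simp: t_def)
  have off: "(\<tau>, ?v) \<in> off_divisors U" using t \<tau> U(2) by (intro small_positive_off_divisors) auto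
  have "norm ?v \<le> (\<Sum>i\<in>UNIV. norm (?v $ i))"
    unfolding norm_vec_def by (rule L2_set_le_sum) simp
  also have "\<dots> < r" using t by (simp add: sum_3)
  finally have "norm ?v < r" .
  have "euler_section \<epsilon> U (\<tau>, ?v) / theta3_frame (\<lambda>_ z. z) (\<tau>, ?v) powi \<epsilon> = 0"
    by (rule has_sum_unique[OF r(2)[OF \<open>norm ?v < r\<close> off]]) (rule has_sum_0, rule refl)
  moreover have "theta3_frame (\<lambda>_ z. z) (\<tau>, ?v) \<noteq> 0" using t by (simp add: theta3_frame_def flip: of_real_add)
  moreover have "euler_section \<epsilon> U (\<tau>, ?v) \<noteq> 0"
    using theta3_frame_upsilon_nonzero[OF off U(1)] off by (simp add: euler_section_def)
  ultimately show False by simp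
qed

text \<open>A section differs from the Euler section by a function of \<open>\<tau>\<close>. Its completion
is multiplied by the same function, and one nonzero Taylor coefficient detects that function.\<close>

lemma equivariant_refinement_iff:
  assumes U: "U \<subseteq> upper_half_plane" and \<epsilon>: "\<epsilon> \<in> {1, -1}"
  shows "equivariant_refinement \<epsilon> U s \<longleftrightarrow> s = euler_section \<epsilon> U"
proof
  assume "equivariant_refinement \<epsilon> U s"
  then have sec: "theta3_section \<epsilon> U s" and compl: "completion \<epsilon> U s = completion \<epsilon> U (euler_section \<epsilon> U)"
    by (simp_all add: equivariant_refinement_def AHS_class_eq[OF assms])
  then obtain l h where lh: "frame_O U l" "theta3_coordinate \<epsilon> U l s h"
    unfolding theta3_section_def by blast
  show "s = euler_section \<epsilon> U"
  proof (rule theta3_section_eqI[OF sec])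
    fix \<tau> v assume off: "(\<tau>, v) \<in> off_divisors U"
    then have \<tau>: "\<tau> \<in> U" by (simp add: off_divisors_iff)
    have s: "s (\<tau>, v) = h (\<tau>, 0) * euler_section \<epsilon> U (\<tau>, v)" if "(\<tau>, v) \<in> off_divisors U" for v
      using theta3_coordinate_eq[OF assms sec lh that] that by (simp add: euler_section_def)
    obtain c where c: "has_formal_expansion \<epsilon> U (euler_section \<epsilon> U) \<tau> c"
      using euler_section_has_formal_expansion[OF U \<tau> \<epsilon>] by blast
    have "has_formal_expansion \<epsilon> U s \<tau> (\<lambda>i. h (\<tau>, 0) * c i)"
      by (rule has_formal_expansion_scale[OF c s])
    then have "h (\<tau>, 0) * c i = c i" for i
      using completion_eq[OF U \<tau>] completion_eq[OF U \<tau> c] compl by metis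
    moreover obtain i where "c i \<noteq> 0" using euler_section_expansion_nonzero[OF U \<tau> c] by blast
    ultimately have "h (\<tau>, 0) = 1" by (metis mult_cancel_right1)
    then show "s (\<tau>, v) = theta3_frame upsilon (\<tau>, v) powi \<epsilon>"
      using s[OF off] off by (simp add: euler_section_def)
  qed
next
  assume "s = euler_section \<epsilon> U"
  then show "equivariant_refinement \<epsilon> U s"
    using theta3_section_euler_section[OF U] by (simp add: equivariant_refinement_def AHS_class_eq[OF assms])
qed

section \<open>Modular invariance\<close>

lemma moebius_facts:
  assumes det: "a * d - b * c = (1 :: int)" and \<tau>: "Im \<tau> > 0"
  shows "of_int c * \<tau> + of_int d \<noteq> 0"
    and "Im ((of_int a * \<tau> + of_int b) / (of_int c * \<tau> + of_int d)) > 0"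
proof -
  show nz: "of_int c * \<tau> + of_int d \<noteq> 0"
  proof
    assume eq: "of_int c * \<tau> + of_int d = 0"
    from arg_cong[OF eq, of Im] have "c = 0" using \<tau> by simp
    with arg_cong[OF eq, of Re] have "d = 0" by simp
    with \<open>c = 0\<close> det show False by simp
  qed
  let ?j = "of_int c * \<tau> + of_int d"
  have "Im ((of_int a * \<tau> + of_int b) * cnj ?j) = of_int (a * d - b * c) * Im \<tau>"
    by (simp add: algebra_simps)
  then have "Im ((of_int a * \<tau> + of_int b) / ?j) = Im \<tau> / (norm ?j)\<^sup>2"
    unfolding det complex_div_cnj[of _ ?j] by (simp flip: of_real_power)
  then show "Im ((of_int a * \<tau> + of_int b) / ?j) > 0" using \<tau> nz by simp
qed

text \<open>With \<open>j = c\<tau> + d\<close> and \<open>\<tau>' = (a\<tau> + b) / j\<close>, division by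
\<open>j\<close> carries the lattice of \<open>\<tau>\<close> to that of \<open>\<tau>'\<close>,
acting on the coefficients through the integral matrix itself.\<close>

lemma moebius_lattice_shift:
  fixes a b c d n m :: int and \<tau> z :: complex
  defines "j \<equiv> of_int c * \<tau> + of_int d" and "\<tau>' \<equiv> (of_int a * \<tau> + of_int b) / (of_int c * \<tau> + of_int d)"
  assumes det: "a * d - b * c = 1" and nz: "j \<noteq> 0"
  shows "inverse j * (z + of_int n - \<tau> * of_int m) =
    inverse j * z + of_int (a * n + b * m) - \<tau>' * of_int (c * n + d * m)"
proof -
  have "(of_int a :: complex) * of_int d - of_int b * of_int c = 1"
    using det by (metis of_int_1 of_int_diff of_int_mult)
  then have *: "j * of_int (a * n + b * m) - (of_int a * \<tau> + of_int b) * of_int (c * n + d * m) = of_int n - \<tau> * of_int m"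
    unfolding j_def of_int_add of_int_mult by algebra
  have "inverse j * z + of_int (a * n + b * m) - \<tau>' * of_int (c * n + d * m) =
     inverse j * (z + (j * of_int (a * n + b * m) - (of_int a * \<tau> + of_int b) * of_int (c * n + d * m)))"
    unfolding \<tau>'_def j_def[symmetric] using nz by (simp add: field_simps)
  then show ?thesis unfolding * by simp
qed

lemma moebius_period_lattice_iff:
  fixes a b c d :: int and \<tau> z :: complex
  defines "j \<equiv> of_int c * \<tau> + of_int d" and "\<tau>' \<equiv> (of_int a * \<tau> + of_int b) / (of_int c * \<tau> + of_int d)"
  assumes det: "a * d - b * c = 1" and nz: "j \<noteq> 0"
  shows "inverse j * z \<in> period_lattice \<tau>' \<longleftrightarrow> z \<in> period_lattice \<tau>"
proof -
  have shift: "inverse j * (of_int n - \<tau> * of_int m) = of_int (a * n + b * m) - \<tau>' * of_int (c * n + d * m)" for n m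
    using moebius_lattice_shift[of a d b c \<tau> 0 n m, folded \<tau>'_def, folded j_def, OF det nz] by simp
  show ?thesis
  proof
    assume "z \<in> period_lattice \<tau>"
    then obtain n m :: int where "z = of_int n - \<tau> * of_int m" by (auto simp: period_lattice_def)
    then have "inverse j * z = of_int (a * n + b * m) - \<tau>' * of_int (c * n + d * m)"
      by (simp only: shift)
    then show "inverse j * z \<in> period_lattice \<tau>'" unfolding period_lattice_def by blast
  next
    assume "inverse j * z \<in> period_lattice \<tau>'"
    then obtain n m :: int where nm: "inverse j * z = of_int n - \<tau>' * of_int m" by (auto simp: period_lattice_def)
    have "a * (d * n - b * m) + b * (a * m - c * n) = n" "c * (d * n - b * m) + d * (a * m - c * n) = m"
      using det by algebra+
    then have "inverse j * (of_int (d * n - b * m) - \<tau> * of_int (a * m - c * n)) = inverse j * z"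
      by (simp only: shift nm)
    then have "z = of_int (d * n - b * m) - \<tau> * of_int (a * m - c * n)" using nz by simp
    then show "z \<in> period_lattice \<tau>" unfolding period_lattice_def by blast
  qed
qed

text \<open>Rigidity is applied to \<open>l(z) = \<upsilon>(\<tau>', z/j)\<close>. Its derivative at
\<open>0\<close> carries a factor \<open>j\<^sup>-\<^sup>1\<close>, which accounts for the
weight factor in the action on sections.\<close>

lemma SL2Z_invariant_euler_section:
  assumes \<epsilon>: "\<epsilon> \<in> {1, -1}"
  shows "SL2Z_invariant \<epsilon> (euler_section \<epsilon> upper_half_plane)"
  unfolding SL2Z_invariant_def
proof (intro allI ballI impI)
  fix a b c d :: int and \<tau> v
  assume det: "a * d - b * c = 1" and \<tau>H: "\<tau> \<in> upper_half_plane"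
  then have \<tau>: "Im \<tau> > 0" by (simp add: upper_half_plane_def)
  define j where "j = of_int c * \<tau> + of_int d"
  define \<tau>' where "\<tau>' = (of_int a * \<tau> + of_int b) / j"
  have j: "j \<noteq> 0" and \<tau>': "Im \<tau>' > 0" using moebius_facts[OF det \<tau>] by (simp_all add: j_def \<tau>'_def)
  note lattice = moebius_period_lattice_iff[OF det, of \<tau>, folded j_def, folded \<tau>'_def, OF j]
  note shift = moebius_lattice_shift[OF det, of \<tau>, folded j_def, folded \<tau>'_def, OF j]
  have off: "(\<tau>', inverse j *s w) \<in> off_divisors upper_half_plane \<longleftrightarrow> (\<tau>, w) \<in> off_divisors upper_half_plane" for w
    using \<tau> \<tau>' by (simp add: off_divisors_iff upper_half_plane_def lattice flip: distrib_left)
  define l where "l = (\<lambda>(_ :: complex) z. upsilon \<tau>' (inverse j * z))"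
  have dl: "(l \<tau> has_field_derivative deriv (upsilon \<tau>') (inverse j * z) * inverse j) (at z)" for z
  proof -
    have "(upsilon \<tau>' has_field_derivative deriv (upsilon \<tau>') (inverse j * z)) (at (inverse j * z))"
      by (rule field_differentiable_derivI[OF upsilon_field_differentiable(2)[OF \<tau>']])
    then show ?thesis unfolding l_def
      by (rule DERIV_chain2) (auto intro!: derivative_eq_intros)
  qed
  have frame: "theta3_frame l (\<tau>, w) = j * theta3_frame upsilon (\<tau>', inverse j *s w)" for w
  proof -
    have "deriv (l \<tau>) 0 = deriv (upsilon \<tau>') 0 * inverse j"
      using DERIV_imp_deriv[OF dl[of 0]] by simp
    then show ?thesis
      by (simp only: theta3_frame_def case_prod_conv) (simp add: l_def distrib_left divide_inverse mult_ac)
  qed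
  define s where "s = (\<lambda>p. if p \<in> off_divisors upper_half_plane then theta3_frame l p powi \<epsilon> else 0)"
  have "s (\<tau>, w) = 1 * theta3_frame upsilon (\<tau>, w) powi \<epsilon>" if "(\<tau>, w) \<in> off_divisors upper_half_plane" for w
  proof (rule theta3_rigidity[where h = "\<lambda>_. 1" and l = l and U = upper_half_plane])
    show "l \<tau> holomorphic_on UNIV"
      using dl by (auto simp: holomorphic_on_def field_differentiable_def intro: DERIV_subset)
    show "l \<tau> z = 0 \<longleftrightarrow> z \<in> period_lattice \<tau>" for z
      using upsilon_eq_0_iff[OF \<tau>'] lattice by (simp add: l_def)
    show "deriv (l \<tau>) z \<noteq> 0" if "z \<in> period_lattice \<tau>" for z
      using upsilon_simple_zero[OF \<tau>', of "inverse j * z"] that j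
      unfolding DERIV_imp_deriv[OF dl] by (simp add: lattice)
    show "s (\<tau>, w) = 1 * theta3_frame l (\<tau>, w) powi \<epsilon>" if "(\<tau>, w) \<in> off_divisors upper_half_plane" for w
      using that by (simp add: s_def)
    fix w and n m :: "int ^ 3"
    let ?n = "\<chi> i. a * n $ i + b * m $ i" and ?m = "\<chi> i. c * n $ i + d * m $ i"
    have "inverse j *s (\<chi> i. w $ i + of_int (n $ i) - \<tau> * of_int (m $ i)) =
        (\<chi> i. (inverse j *s w) $ i + of_int (?n $ i) - \<tau>' * of_int (?m $ i))"
      by (simp only: vec_eq_iff vector_smult_component vec_lambda_beta shift simp_thms)
    then have "theta3_frame l (\<tau>, \<chi> i. w $ i + of_int (n $ i) - \<tau> * of_int (m $ i)) = theta3_frame l (\<tau>, w)"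
      by (simp only: frame theta3_frame_upsilon_shift[OF \<tau>'])
    then show "s (\<tau>, \<chi> i. w $ i + of_int (n $ i) - \<tau> * of_int (m $ i)) = s (\<tau>, w)"
      by (simp only: s_def off_divisors_shift_iff)
  qed (use \<tau>H \<epsilon> that in auto)
  then have eq: "theta3_frame l (\<tau>, w) powi \<epsilon> = theta3_frame upsilon (\<tau>, w) powi \<epsilon>"
    if "(\<tau>, w) \<in> off_divisors upper_half_plane" for w using that by (simp add: s_def)
  have "j powi \<epsilon> * euler_section \<epsilon> upper_half_plane (\<tau>', inverse j *s v) = euler_section \<epsilon> upper_half_plane (\<tau>, v)"
    using eq[of v] by (simp add: euler_section_def off frame power_int_mult_distrib)
  then show "(of_int c * \<tau> + of_int d) powi \<epsilon> * euler_section \<epsilon> upper_half_plane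
       ((of_int a * \<tau> + of_int b) / (of_int c * \<tau> + of_int d), inverse (of_int c * \<tau> + of_int d) *s v) =
     euler_section \<epsilon> upper_half_plane (\<tau>, v)"
    by (simp only: j_def \<tau>'_def)
qed

section \<open>The Euler class of \<open>V\<^sub>3\<close>\<close>

text \<open>A normal form for characters in which equality and addition are decided by the simplifier.\<close>

definition character3 :: "int \<Rightarrow> int \<Rightarrow> int \<Rightarrow> int ^ 3" where
  "character3 a b c = vector [a, b, c]"

lemma character3_eq_iff: "character3 a b c = character3 a' b' c' \<longleftrightarrow> a = a' \<and> b = b' \<and> c = c'"
  by (auto simp: character3_def vec_eq_iff forall_3)

lemma character3_add: "character3 a b c + character3 a' b' c' = character3 (a + a') (b + b') (c + c')"
  by (simp add: character3_def vec_eq_iff forall_3)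

lemma zero_eq_character3: "0 = character3 0 0 0"
  by (simp add: character3_def vec_eq_iff forall_3)

lemma taut_eq: "taut 1 = Poly_Mapping.single (character3 1 0 0) 1"
  "taut 2 = Poly_Mapping.single (character3 0 1 0) 1"
  "taut 3 = Poly_Mapping.single (character3 0 0 1) 1"
proof -
  have "axis 1 1 = character3 1 0 0" "axis 2 1 = character3 0 1 0" "axis 3 1 = character3 0 0 1"
    unfolding vec_eq_iff forall_3 character3_def vector_3 axis_def vec_lambda_beta by simp_all
  then show "taut 1 = Poly_Mapping.single (character3 1 0 0) 1"
    "taut 2 = Poly_Mapping.single (character3 0 1 0) 1"
    "taut 3 = Poly_Mapping.single (character3 0 0 1) 1"
    by (simp_all add: taut_def)
qed

lemma V3_eq:
  "V3 = (let L = \<lambda>a b c. Poly_Mapping.single (character3 a b c) 1 in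
     L 1 1 1 - L 1 1 0 - L 1 0 1 - L 0 1 1 + L 1 0 0 + L 0 1 0 + L 0 0 1 - L 0 0 0)"
proof -
  have one: "(1 :: rep_ring) = Poly_Mapping.single (character3 0 0 0) 1"
    by (simp flip: zero_eq_character3)
  show ?thesis unfolding V3_def taut_eq one Let_def
    by (simp add: algebra_simps mult_single character3_add)
qed

lemma euler_character_character3:
  "euler_character \<theta> (character3 a b c) (\<tau>, v) =
     (if a = 0 \<and> b = 0 \<and> c = 0 then deriv (\<theta> \<tau>) 0
      else \<theta> \<tau> (of_int a * v$1 + of_int b * v$2 + of_int c * v$3))"
  by (simp add: euler_character_def zero_eq_character3 character3_eq_iff) (simp add: character3_def sum_3)

lemma euler_class_V3: "euler_class \<theta> V3 p = theta3_frame \<theta> p"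
proof -
  obtain \<tau> v where p: "p = (\<tau>, v)" by (cases p)
  \<comment> \<open>The vertices of the cube; the trivial character enters with multiplicity \<open>-1\<close> and contributes the derivative.\<close>
  let ?A = "{character3 1 1 1, character3 1 1 0, character3 1 0 1, character3 0 1 1,
     character3 1 0 0, character3 0 1 0, character3 0 0 1, character3 0 0 0}"
  have lookup: "Poly_Mapping.lookup V3 a =
     (1 when character3 1 1 1 = a) - (1 when character3 1 1 0 = a) - (1 when character3 1 0 1 = a)
     - (1 when character3 0 1 1 = a) + (1 when character3 1 0 0 = a) + (1 when character3 0 1 0 = a)
     + (1 when character3 0 0 1 = a) - (1 when character3 0 0 0 = a)" for a
    by (simp only: V3_eq Let_def lookup_minus lookup_add lookup_single)
  have "Poly_Mapping.keys V3 \<subseteq> ?A"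
  proof
    fix a assume "a \<in> Poly_Mapping.keys V3"
    then have "Poly_Mapping.lookup V3 a \<noteq> 0" by (simp add: in_keys_iff)
    then show "a \<in> ?A" unfolding lookup by (rule contrapos_np) (auto simp: when_def)
  qed
  then have "euler_class \<theta> V3 p = (\<Prod>a\<in>?A. euler_character \<theta> a p powi Poly_Mapping.lookup V3 a)"
    unfolding euler_class_def by (rule prod.mono_neutral_left[rotated]) (auto simp: in_keys_iff)
  also have "\<dots> = theta3_frame \<theta> p"
    unfolding lookup
    by (simp add: character3_eq_iff when_def p euler_character_character3 theta3_frame_def
        power_int_minus divide_inverse mult_ac)
  finally show ?thesis .
qed

theorem theorem7p11:
  fixes U :: "complex set" and \<epsilon> :: int
  assumes "U \<subseteq> upper_half_plane" and "holomorphic_submanifold U" and "\<epsilon> \<in> {1, -1}"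
  shows "(\<exists>!s. equivariant_refinement \<epsilon> U s) \<and>
    (\<forall>s. equivariant_refinement \<epsilon> U s \<longrightarrow>
      (\<forall>p\<in>off_divisors U. s p = euler_class upsilon V3 p powi \<epsilon>) \<and>
      (U = upper_half_plane \<longrightarrow> SL2Z_invariant \<epsilon> s))"
  unfolding equivariant_refinement_iff[OF assms(1,3)]
  using SL2Z_invariant_euler_section[OF assms(3)]
  by (auto simp: euler_section_def euler_class_V3)

end
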